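(* Assume A1 and A3, and let $X_i\sim N(\theta_i,\nu_{p,i})$ and $Z_i\sim N(0,1)$ be independent. Then for every coordinate $i$, with $a_n=\log\log n$, I. $\displaystyle\lim_{n\to\infty}\ \sup_{\tau\in[0,\infty],\,\theta_i\in\mathbb{R}}a_n^8\,\big|\mathrm{Bias}_{\theta_i}\big(\hat T_i(X_i,Z_i,\tau)\big)\big|=0$; II. $\displaystyle\lim_{n\to\infty}\ \sup_{\tau\in[0,\infty],\,\theta_i\in\mathbb{R}}n^{-1}a_n^8\,\mathrm{Var}_{\theta_i}\big(\hat T_i(X_i,Z_i,\tau)\big)=0$, where $\mathrm{Bias}_{\theta_i}(\hat T_i(X_i,Z_i,\tau))=\mathbb{E}_{\theta_i}[\hat T_i(X_i,Z_i,\tau)]-G\big(c_i(\tau)+d_i(\tau)\theta_i,\tilde b_i\big)$.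
   Context: $(\nu_{p,i}),(\nu_{f,i}),(b_i),(h_i)$, $i\ge1$, are sequences of positive numbers. $N(\mu,\nu)$ is the normal law with mean $\mu$ and variance $\nu$; $\phi,\Phi$ are the standard normal density and CDF; $\tilde b_i=b_i/(b_i+h_i)$; $G(w,\beta)=\phi(w)+w\Phi(w)-\beta w$, with $G'$ its derivative in the first argument. The dimension $n$ is large enough that $\log\log n>0$. Assumptions. A1: $0<\inf_i\tilde b_i\le\sup_i\tilde b_i<1$ and $\sup_i(b_i+h_i)<\infty$. A3: $\sup_i\nu_{p,i}/\nu_{f,i}<1/(4e)$, $\sup_i\nu_{f,i}<\infty$, $\inf_i\nu_{p,i}>0$. For $\tau\in[0,\infty]$ let $\alpha_i(\tau)=\tau/(\tau+\nu_{p,i})$ ($\alpha_i(\infty)=1$), $$c_i(\tau)=\sqrt{\frac{\nu_{f,i}+\alpha_i(\tau)\nu_{p,i}}{\nu_{f,i}+\alpha_i(\tau)^2\nu_{p,i}}}\;\Phi^{-1}(\tilde b_i),\qquad d_i(\tau)=-\frac{1-\alpha_i(\tau)}{\sqrt{\nu_{f,i}+\alpha_i(\tau)^2\nu_{p,i}}},\qquad s_i(\tau)=\sqrt{2\nu_{p,i}}\,|d_i(\tau)|.$$ Fix for each $i$ any number $\gamma(i)$ with $0<\gamma(i)<1/\sqrt{4e}-\sqrt{\nu_{p,i}/\nu_{f,i}}$, and set $\lambda_n(i)=\gamma(i)\sqrt{2\log n}$ and $K_n(i)=1+\big\lceil e^2\big(\gamma(i)+\sqrt{2\nu_{p,i}/\nu_{f,i}}\big)^2(2\log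 n)\big\rceil$. With $H_k$ the probabilists' Hermite polynomials, put $$S_{i,\tau}(u)=G(0,\tilde b_i)+G'(0,\tilde b_i)\,u+\phi(0)\sum_{k=0}^{K_n(i)-2}\frac{(-1)^kH_k(0)}{(k+2)!}\,s_i(\tau)^{k+2}H_{k+2}\big(u/s_i(\tau)\big)$$ (when $s_i(\tau)=0$, $s^{m}H_m(u/s)$ is read as its limit $u^m$), and $\tilde S_{i,\tau}(u)=\mathrm{sign}(S_{i,\tau}(u))\min\{|S_{i,\tau}(u)|,n\}$. For $x,z\in\mathbb{R}$ let $U=c_i(\tau)+d_i(\tau)(x+\sqrt{\nu_{p,i}}z)$, $V=c_i(\tau)+d_i(\tau)(x-\sqrt{\nu_{p,i}}z)$, and define $\hat T_i(x,z,\tau)=-\tilde b_iU$ if $V<-\lambda_n(i)$; $=\tilde S_{i,\tau}(U)$ if $|V|\le\lambda_n(i)$; $=(1-\tilde b_i)U$ if $V>\lambda_n(i)$. *)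

theory Defs
  imports "HOL-Probability.Probability" "HOL-Computational_Algebra.Polynomial"
begin

abbreviation Phi :: "real \<Rightarrow> real" where
  "Phi \<equiv> cdf std_normal_distribution"

(* Phi is injective with range (0,1); Phi_inv is only meaningful on that interval. *)
definition Phi_inv :: "real \<Rightarrow> real" where
  "Phi_inv = the_inv Phi"

definition G :: "real \<Rightarrow> real \<Rightarrow> real" where
  "G w \<beta> = std_normal_density w + w * Phi w - \<beta> * w"

definition critical_ratio :: "real \<Rightarrow> real \<Rightarrow> real" where
  "critical_ratio b h = b / (b + h)"

(* Probabilists' normalisation, i.e. the Rodrigues formula
   H_k(x) = (-1)^k exp(x^2/2) (d/dx)^k exp(-x^2/2) unrolled one derivative at a time;
   see hermite_Rodrigues. *)
primrec hermite :: "nat \<Rightarrow> real poly" where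
  "hermite 0 = 1"
| "hermite (Suc k) = [:0, 1:] * hermite k - pderiv (hermite k)"

lemma hermite_Rodrigues:
  "(deriv ^^ k) (\<lambda>x. exp (- x\<^sup>2 / 2)) =
     (\<lambda>x. (-1) ^ k * poly (hermite k) x * exp (- x\<^sup>2 / 2))"
proof (induction k)
  case 0
  show ?case by simp
next
  case (Suc k)
  have "((\<lambda>x. (-1) ^ k * poly (hermite k) x * exp (- x\<^sup>2 / 2)) has_real_derivative
      (-1) ^ Suc k * poly (hermite (Suc k)) x * exp (- x\<^sup>2 / 2)) (at x)" for x
    by (auto intro!: derivative_eq_intros simp: field_simps)
  then show ?case
    unfolding funpow.simps o_def Suc.IH by (intro ext DERIV_imp_deriv)
qed

(* s^m H_m(u/s), extended to s = 0 by its limit u^m. *)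
definition scaled_hermite :: "nat \<Rightarrow> real \<Rightarrow> real \<Rightarrow> real" where
  "scaled_hermite m s u = (if s = 0 then u ^ m else s ^ m * poly (hermite m) (u / s))"

(* Below, vp, vf, \<beta>, g are the values of nu_p, nu_f, b/(b+h), gamma at one coordinate.
   The shrinkage parameter ranges over [0,\<infinity>], which is exactly the type ennreal. *)

definition shrink :: "real \<Rightarrow> ennreal \<Rightarrow> real" where
  "shrink vp \<tau> = (if \<tau> = \<infinity> then 1 else enn2real \<tau> / (enn2real \<tau> + vp))"

definition c_coef :: "real \<Rightarrow> real \<Rightarrow> real \<Rightarrow> ennreal \<Rightarrow> real" where
  "c_coef vp vf \<beta> \<tau> =
     sqrt ((vf + shrink vp \<tau> * vp) / (vf + (shrink vp \<tau>)\<^sup>2 * vp)) * Phi_inv \<beta>"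

definition d_coef :: "real \<Rightarrow> real \<Rightarrow> ennreal \<Rightarrow> real" where
  "d_coef vp vf \<tau> = - ((1 - shrink vp \<tau>) / sqrt (vf + (shrink vp \<tau>)\<^sup>2 * vp))"

definition s_scale :: "real \<Rightarrow> real \<Rightarrow> ennreal \<Rightarrow> real" where
  "s_scale vp vf \<tau> = sqrt (2 * vp) * \<bar>d_coef vp vf \<tau>\<bar>"

definition threshold :: "real \<Rightarrow> nat \<Rightarrow> real" where
  "threshold g n = g * sqrt (2 * ln (real n))"

definition K_order :: "real \<Rightarrow> real \<Rightarrow> real \<Rightarrow> nat \<Rightarrow> nat" where
  "K_order vp vf g n =
     1 + nat \<lceil>(exp 1)\<^sup>2 * (g + sqrt (2 * vp / vf))\<^sup>2 * (2 * ln (real n))\<rceil>"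

(* The index set {..<K - 1} is {0..K - 2}, and, unlike the latter on nat, empty for K = 1. *)
definition S_series :: "real \<Rightarrow> real \<Rightarrow> real \<Rightarrow> real \<Rightarrow> nat \<Rightarrow> ennreal \<Rightarrow> real \<Rightarrow> real" where
  "S_series vp vf \<beta> g n \<tau> u =
     G 0 \<beta> + deriv (\<lambda>w. G w \<beta>) 0 * u
     + std_normal_density 0 *
       (\<Sum>k<K_order vp vf g n - 1.
          (-1) ^ k * poly (hermite k) 0 / fact (k + 2)
            * scaled_hermite (k + 2) (s_scale vp vf \<tau>) u)"

definition S_trunc :: "real \<Rightarrow> real \<Rightarrow> real \<Rightarrow> real \<Rightarrow> nat \<Rightarrow> ennreal \<Rightarrow> real \<Rightarrow> real" where
  "S_trunc vp vf \<beta> g n \<tau> u =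
     sgn (S_series vp vf \<beta> g n \<tau> u) * min \<bar>S_series vp vf \<beta> g n \<tau> u\<bar> (real n)"

definition T_hat ::
    "real \<Rightarrow> real \<Rightarrow> real \<Rightarrow> real \<Rightarrow> nat \<Rightarrow> real \<Rightarrow> real \<Rightarrow> ennreal \<Rightarrow> real" where
  "T_hat vp vf \<beta> g n x z \<tau> =
     (let U = c_coef vp vf \<beta> \<tau> + d_coef vp vf \<tau> * (x + sqrt vp * z);
          V = c_coef vp vf \<beta> \<tau> + d_coef vp vf \<tau> * (x - sqrt vp * z)
      in if V < - threshold g n then - \<beta> * U
         else if \<bar>V\<bar> \<le> threshold g n then S_trunc vp vf \<beta> g n \<tau> U
         else (1 - \<beta>) * U)"

definition bias ::
    "'w measure \<Rightarrow> ('w \<Rightarrow> real) \<Rightarrow> real \<Rightarrow> real" where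
  "bias M T target = prob_space.expectation M T - target"

end

theory Submission
  imports Defs "HOL-Real_Asymp.Real_Asymp"
begin

text \<open>
  Put \<open>m = c + d \<theta>\<close> and \<open>s = sqrt (2 \<nu>\<^sub>p) |d|\<close>. By rotation invariance of the planar Gaussian law,
  \<open>U\<close> and \<open>V\<close> are independent \<open>N(m, s\<^sup>2)\<close> variables, so bias and variance split into products of
  probabilities of events of \<open>V\<close> and moments of functions of \<open>U\<close>; all estimates are uniform in
  \<open>m \<in> \<real>\<close> and \<open>0 \<le> s \<le> sqrt (2 \<nu>\<^sub>p / \<nu>\<^sub>f)\<close>, whatever the value of \<open>c\<close>.

  On the outer events, the linear branches differ from \<open>G\<close> by a term that is Gaussian-small in \<open>m\<close>
  unless the event itself is improbable. On the middle event, the rescaled Hermite polynomials are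
  unbiased for the powers of \<open>m\<close>, so the series estimates a Taylor polynomial of \<open>G\<close>. For \<open>|m|\<close> up to a
  constant times \<open>sqrt (log n)\<close> the Taylor remainder is geometrically small in the order, while
  \<open>E h\<^sub>k(U)\<^sup>2 \<le> k! exp (m\<^sup>2 / (1 - s\<^sup>2))\<close>, for the \<open>k\<close>-th rescaled polynomial \<open>h\<^sub>k\<close>, keeps the second
  moment of the series below \<open>n\<^sup>9\<^sup>/\<^sup>1\<^sup>0\<close> up to logarithms, which also controls the effect of truncation
  at \<open>n\<close>. For larger \<open>|m|\<close> the middle event has probability of order \<open>n\<^sup>-\<^sup>4\<^sup>/\<^sup>3\<close>, which beats the
  bound \<open>n\<close> on the truncated series.
\<close>

section \<open>Hermite polynomials under the standard normal law\<close>

interpretation std_normal: real_distribution std_normal_distribution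
  by (rule real_dist_normal_dist)

lemma pderiv_sum: "pderiv (sum f A) = (\<Sum>x\<in>A. pderiv (f x))"
  using higher_pderiv_sum[of 1 f A] by simp

text \<open>Translation by \<open>m\<close> commutes with differentiation, so it only changes the
  factor \<open>x\<close> of the recursion into \<open>x + m\<close>. The \<open>x\<close> part
  raises each \<open>hermite j\<close> to its successor, the \<open>m\<close> part raises the power
  of \<open>m\<close>.\<close>

lemma pcompose_hermite_translate:
  "pcompose (hermite k) [:m, 1:] = (\<Sum>j\<le>k. smult (of_nat (k choose j) * m ^ (k - j)) (hermite j))"
proof (induction k)
  case 0
  show ?case by (simp add: pcompose_1)
next
  case (Suc k)
  let ?t = "\<lambda>k j. smult (of_nat (k choose j) * m ^ (k - j)) (hermite j)"
  let ?u = "\<lambda>j. smult (of_nat (k choose j) * m ^ (k - j)) (hermite (Suc j))"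
  let ?v = "\<lambda>j. smult (of_nat (k choose j) * m ^ (Suc k - j)) (hermite j)"
  have u: "[:0, 1:] * ?t k j - pderiv (?t k j) = ?u j" for j
    by (simp add: smult_diff_right pderiv_smult)
  have v: "smult m (?t k j) = ?v j" if "j \<le> k" for j
    using that by (simp add: Suc_diff_le mult_ac)
  have "pcompose (hermite (Suc k)) [:m, 1:]
      = [:m, 1:] * pcompose (hermite k) [:m, 1:] - pderiv (pcompose (hermite k) [:m, 1:])"
    by (simp add: pcompose_diff pcompose_mult pcompose_pCons pderiv_pcompose)
       (simp add: pderiv_pCons)
  also have "\<dots> = (\<Sum>j\<le>k. [:0, 1:] * ?t k j - pderiv (?t k j)) + (\<Sum>j\<le>k. smult m (?t k j))"
  proof -
    have "[:m, 1:] * q = [:0, 1:] * q + [:m:] * q" for q :: "real poly"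
      by simp
    moreover have "[:m:] * q = smult m q" for q :: "real poly"
      by simp
    ultimately show ?thesis
      unfolding Suc.IH by (simp only: sum_subtractf pderiv_sum sum_distrib_left) (simp add: algebra_simps sum.distrib)
  qed
  also have "\<dots> = (\<Sum>j\<le>k. ?u j) + (\<Sum>j\<le>k. ?v j)"
    using u v by simp
  \<comment> \<open>The added term vanishes because \<open>k choose Suc k\<close> is zero. It aligns
    the sums for an index shift, after which Pascal's rule merges them.\<close>
  also have "(\<Sum>j\<le>k. ?v j) = (\<Sum>j\<le>Suc k. ?v j)"
    by simp
  also have "\<dots> = ?v 0 + (\<Sum>j\<le>k. ?v (Suc j))"
    by (rule sum.atMost_Suc_shift)
  also have "(\<Sum>j\<le>k. ?u j) + (?v 0 + (\<Sum>j\<le>k. ?v (Suc j))) = ?v 0 + (\<Sum>j\<le>k. ?u j + ?v (Suc j))"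
    by (simp only: sum.distrib add_ac)
  also have "\<dots> = ?t (Suc k) 0 + (\<Sum>j\<le>k. ?t (Suc k) (Suc j))"
    by (intro arg_cong2[of _ _ _ _ "(+)"] sum.cong refl)
       (auto simp del: hermite.simps simp: smult_add_left[symmetric] algebra_simps)
  also have "\<dots> = (\<Sum>j\<le>Suc k. ?t (Suc k) j)"
    by (rule sum.atMost_Suc_shift[symmetric])
  finally show ?case .
qed

text \<open>Expands in the \<open>hermite j\<close> of a standard normal variable, which are
  orthogonal. No division by \<open>s\<close> remains, and at \<open>s = 0\<close> only
  \<open>j = 0\<close> contributes since \<open>0 ^ 0 = 1\<close>.\<close>

lemma scaled_hermite_translate:
  "scaled_hermite k s (m + s * x) =
     (\<Sum>j\<le>k. of_nat (k choose j) * m ^ (k - j) * s ^ j * poly (hermite j) x)"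
proof (cases "s = 0")
  case True
  have "(\<Sum>j\<le>k. of_nat (k choose j) * m ^ (k - j) * 0 ^ j * poly (hermite j) x)
      = (\<Sum>j\<le>k. if j = 0 then m ^ k else 0)"
    by (intro sum.cong) auto
  then show ?thesis
    using True by (simp add: scaled_hermite_def)
next
  case False
  have "poly (hermite k) ((m + s * x) / s) = poly (pcompose (hermite k) [:m / s, 1:]) x"
    using False by (simp add: poly_pcompose add_divide_distrib)
  then show ?thesis
    using False unfolding scaled_hermite_def pcompose_hermite_translate
    by (auto simp: poly_sum sum_distrib_left power_divide power_diff intro!: sum.cong)
qed

lemma pderiv_hermite: "pderiv (hermite (Suc k)) = smult (of_nat (Suc k)) (hermite k)"
proof (induction k)
  case 0
  show ?case by (simp add: pderiv_pCons)
next
  case (Suc k)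
  have "pderiv (hermite (Suc (Suc k)))
     = pderiv ([:0, 1:] * hermite (Suc k)) - pderiv (pderiv (hermite (Suc k)))"
    by (subst hermite.simps(2)) (rule pderiv_diff)
  also have "pderiv ([:0, 1:] * hermite (Suc k)) = hermite (Suc k) + [:0, 1:] * pderiv (hermite (Suc k))"
    by (simp del: hermite.simps add: pderiv_pCons)
  \<comment> \<open>The induction hypothesis collects the derivative terms into a multiple of the
    bracket that defines \<open>hermite (Suc k)\<close>.\<close>
  also have "\<dots> - pderiv (pderiv (hermite (Suc k)))
      = hermite (Suc k) + smult (of_nat (Suc k)) ([:0, 1:] * hermite k - pderiv (hermite k))"
    unfolding Suc.IH by (simp del: hermite.simps of_nat_Suc add: pderiv_smult smult_diff_right)
  also have "\<dots> = smult (of_nat (Suc (Suc k))) (hermite (Suc k))"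
    unfolding hermite.simps(2)[symmetric] by (simp only: of_nat_Suc[of "Suc k"] smult_add_left smult_1_left)
  finally show ?case .
qed

lemma poly_hermite_0_Suc_Suc:
  "poly (hermite (Suc (Suc k))) 0 = - (real k + 1) * poly (hermite k) 0"
proof -
  have "poly (hermite (Suc (Suc k))) 0 = - poly (pderiv (hermite (Suc k))) 0"
    by (subst hermite.simps(2)) (simp del: hermite.simps)
  then show ?thesis
    unfolding pderiv_hermite by (simp add: algebra_simps)
qed

lemma poly_hermite_0_odd: "poly (hermite (Suc (2 * k))) 0 = 0"
  by (induction k) (simp_all add: poly_hermite_0_Suc_Suc pderiv_1 del: hermite.simps(2), simp)

lemma poly_hermite_0_even: "poly (hermite (2 * k)) 0 = (-1) ^ k * fact (2 * k) / (2 ^ k * fact k)"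
proof (induction k)
  case 0
  show ?case by simp
next
  case (Suc k)
  have "poly (hermite (2 * Suc k)) 0 = - (2 * real k + 1) * ((-1) ^ k * fact (2 * k) / (2 ^ k * fact k))"
    using poly_hermite_0_Suc_Suc[of "2 * k"] Suc.IH by simp
  also have "\<dots> = (-1) ^ Suc k * ((2 * real k + 2) * (2 * real k + 1) * fact (2 * k)) / ((2 * real k + 2) * (2 ^ k * fact k))"
    by (simp add: divide_simps) (simp add: algebra_simps)
  also have "(2 * real k + 2) * (2 * real k + 1) * fact (2 * k) = fact (2 * Suc k)"
    by (simp add: algebra_simps)
  also have "(2 * real k + 2) * (2 ^ k * fact k) = 2 ^ Suc k * fact (Suc k)"
    by (simp add: algebra_simps)
  finally show ?case .
qed

text \<open>The two-step recursion multiplies the square by \<open>(j + 1)^2\<close> and the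
  factorial by the larger \<open>(j + 1) * (j + 2)\<close>.\<close>

lemma poly_hermite_0_sq_le: "(poly (hermite k) 0)\<^sup>2 \<le> fact k"
proof (induction k rule: less_induct)
  case (less k)
  consider "k = 0" | "k = 1" | j where "k = Suc (Suc j)"
    by (metis One_nat_def nat.exhaust)
  then show ?case
  proof cases
    case 3
    have "(poly (hermite k) 0)\<^sup>2 = (real j + 1)\<^sup>2 * (poly (hermite j) 0)\<^sup>2"
      unfolding 3 poly_hermite_0_Suc_Suc by (simp only: power_mult_distrib power2_minus)
    also have "\<dots> \<le> (real j + 1)\<^sup>2 * fact j"
      using less.IH[of j] 3 by (intro mult_left_mono) auto
    also have "\<dots> \<le> (real j + 2) * (real j + 1) * fact j"
      by (intro mult_right_mono) (auto simp: power2_eq_square)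
    also have "\<dots> = fact k"
      unfolding 3 by (simp add: algebra_simps)
    finally show ?thesis .
  qed auto
qed

section \<open>Gaussian integrals of polynomials: Stein's identity and orthogonality\<close>

lemma integrable_std_normal_poly: "integrable std_normal_distribution (poly p)"
proof -
  have "integrable std_normal_distribution (\<lambda>x. \<Sum>i\<le>degree p. coeff p i * x ^ i)"
    by (intro Bochner_Integration.integrable_sum integrable_mult_right
          integrable_std_normal_distribution_moment)
  then show ?thesis
    by (simp add: poly_altdef[abs_def])
qed

lemma integrable_std_normal_polyI:
  assumes "\<And>x. f x = poly p x"
  shows "integrable std_normal_distribution f"
proof -
  have "f = poly p" using assms by auto
  then show ?thesis by (simp only: integrable_std_normal_poly)
qed

text \<open>Gaussian integration by parts for monomials, read off from the even moments
  \<open>(2k)! / (2^k k!)\<close>. For even \<open>i > 0\<close> both moments are odd and vanish; at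
  \<open>i = 0\<close> the zero factor hides the truncated \<open>i - 1\<close>.\<close>

lemma std_normal_stein_monom:
  "(LINT x|std_normal_distribution. x ^ Suc i) = of_nat i * (LINT x|std_normal_distribution. x ^ (i - 1))"
proof (cases "odd i")
  case True
  then obtain k where i: "i = Suc (2 * k)" by (elim oddE) auto
  have Suc_i: "Suc i = 2 * Suc k" using i by simp
  have "(LINT x|std_normal_distribution. x ^ Suc i) = fact (2 * Suc k) / (2 ^ Suc k * fact (Suc k))"
    unfolding Suc_i by (rule std_normal_distribution_even_moments)
  also have "fact (2 * Suc k) = (2 * real k + 2) * (real i * fact (2 * k))"
    using i by (simp add: algebra_simps)
  also have "2 ^ Suc k * fact (Suc k) = (2 * real k + 2) * (2 ^ k * fact k)"
    by (simp add: algebra_simps)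
  also have "(2 * real k + 2) * (real i * fact (2 * k)) / ((2 * real k + 2) * (2 ^ k * fact k))
      = real i * (fact (2 * k) / (2 ^ k * fact k))"
    by (subst mult_divide_mult_cancel_left) auto
  finally show ?thesis
    using i std_normal_distribution_even_moments(1)[of k] by simp
next
  case False
  then show ?thesis
    using integral_std_normal_distribution_moment_odd[of "Suc i"]
      integral_std_normal_distribution_moment_odd[of "i - 1"]
    by (cases "i = 0") auto
qed

lemma std_normal_stein_poly:
  "(LINT x|std_normal_distribution. x * poly p x) = (LINT x|std_normal_distribution. poly (pderiv p) x)"
proof -
  note [simp] = integrable_std_normal_distribution_moment
  have "(LINT x|std_normal_distribution. x * poly p x)
     = (LINT x|std_normal_distribution. (\<Sum>i\<le>degree p. coeff p i * x ^ Suc i))"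
    by (simp add: poly_altdef sum_distrib_left mult_ac)
  also have "\<dots> = (\<Sum>i\<le>degree p. coeff p i * (LINT x|std_normal_distribution. x ^ Suc i))"
    by (subst Bochner_Integration.integral_sum)
      (auto intro!: integrable_mult_right integrable_std_normal_distribution_moment simp del: power_Suc)
  also have "\<dots> = (\<Sum>i\<le>degree p. LINT x|std_normal_distribution. poly (pderiv (monom (coeff p i) i)) x)"
    by (simp only: std_normal_stein_monom) (simp add: pderiv_monom poly_monom mult_ac)
  also have "\<dots> = (LINT x|std_normal_distribution. (\<Sum>i\<le>degree p. poly (pderiv (monom (coeff p i) i)) x))"
    by (intro Bochner_Integration.integral_sum[symmetric] integrable_std_normal_poly)
  also have "\<dots> = (LINT x|std_normal_distribution. poly (pderiv (\<Sum>i\<le>degree p. monom (coeff p i) i)) x)"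
    by (simp only: pderiv_sum poly_sum)
  finally show ?thesis
    by (simp only: poly_as_sum_of_monoms)
qed

text \<open>Under the Gaussian law the raising operator of the Hermite recursion is the adjoint of
  differentiation: this is Stein's identity for \<open>hermite i * q\<close>.\<close>

lemma hermite_Suc_inner:
  "(LINT x|std_normal_distribution. poly (hermite (Suc i) * q) x) =
   (LINT x|std_normal_distribution. poly (hermite i * pderiv q) x)"
proof -
  have "(LINT x|std_normal_distribution. poly (hermite (Suc i) * q) x)
     = (LINT x|std_normal_distribution. x * poly (hermite i * q) x - poly (pderiv (hermite i) * q) x)"
    by (simp add: algebra_simps)
  also have "\<dots> = (LINT x|std_normal_distribution. x * poly (hermite i * q) x) -
      (LINT x|std_normal_distribution. poly (pderiv (hermite i) * q) x)"
    by (intro Bochner_Integration.integral_diff integrable_std_normal_poly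
          integrable_std_normal_polyI[of _ "pCons 0 (hermite i * q)"]) simp
  also have "\<dots> = (LINT x|std_normal_distribution. poly (pderiv (hermite i * q)) x - poly (pderiv (hermite i) * q) x)"
    unfolding std_normal_stein_poly
    by (intro Bochner_Integration.integral_diff[symmetric] integrable_std_normal_poly)
  finally show ?thesis
    by (simp add: pderiv_mult algebra_simps)
qed

text \<open>Moving one derivative across lowers both indices, and the multiples so produced build
  the factorial. When just one index has reached zero, the derivative of the constant 1 kills the
  integral.\<close>

lemma hermite_orthogonal:
  "(LINT x|std_normal_distribution. poly (hermite i) x * poly (hermite j) x) = (if i = j then fact i else 0)"
proof (induction i arbitrary: j)
  case 0
  show ?case
  proof (cases j)
    case 0
    then show ?thesis using std_normal.prob_space by simp
  next
    case (Suc j')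
    then show ?thesis using hermite_Suc_inner[of j' 1] by (simp del: hermite.simps(2))
  qed
next
  case (Suc i)
  show ?case
  proof (cases j)
    case 0
    then show ?thesis using hermite_Suc_inner[of i 1] by (simp del: hermite.simps(2))
  next
    case j: (Suc j')
    have "(LINT x|std_normal_distribution. poly (hermite (Suc i)) x * poly (hermite j) x)
      = (LINT x|std_normal_distribution. real (Suc j') * (poly (hermite i) x * poly (hermite j') x))"
      using hermite_Suc_inner[of i "hermite j"] unfolding j pderiv_hermite
      by (simp del: hermite.simps(2) of_nat_Suc add: mult_ac)
    then show ?thesis
      using Suc.IH[of j'] j by simp
  qed
qed

lemma integrable_hermite_prod:
  "integrable std_normal_distribution (\<lambda>x. poly (hermite i) x * poly (hermite j) x)"
  by (rule integrable_std_normal_polyI[of _ "hermite i * hermite j"]) simp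

section \<open>Mean and second moment of the rescaled Hermite polynomials\<close>

lemma scaled_hermite_eq_poly:
  "\<exists>p. \<forall>x. scaled_hermite k s (m + s * x) = poly p x"
  by (rule exI[of _ "\<Sum>j\<le>k. smult (of_nat (k choose j) * m ^ (k - j) * s ^ j) (hermite j)"])
     (simp add: scaled_hermite_translate poly_sum)

lemma integral_scaled_hermite:
  "(LINT x|std_normal_distribution. scaled_hermite k s (m + s * x)) = m ^ k"
proof -
  have "(LINT x|std_normal_distribution. scaled_hermite k s (m + s * x))
      = (\<Sum>j\<le>k. of_nat (k choose j) * m ^ (k - j) * s ^ j *
          (LINT x|std_normal_distribution. poly (hermite j) x * poly (hermite 0) x))"
    unfolding scaled_hermite_translate
    by (subst Bochner_Integration.integral_sum)
       (auto intro!: integrable_mult_right integrable_std_normal_poly)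
  \<comment> \<open>For \<open>j > 0\<close>, \<open>hermite j\<close> is orthogonal to the constant
    \<open>hermite 0\<close>.\<close>
  also have "\<dots> = (\<Sum>j\<le>k. if j = 0 then m ^ k else 0)"
    unfolding hermite_orthogonal by (intro sum.cong) auto
  finally show ?thesis by simp
qed

lemma integral_scaled_hermite_sq:
  "(LINT x|std_normal_distribution. (scaled_hermite k s (m + s * x))\<^sup>2) =
     (\<Sum>j\<le>k. (of_nat (k choose j) * m ^ (k - j) * s ^ j)\<^sup>2 * fact j)"
proof -
  let ?c = "\<lambda>j. of_nat (k choose j) * m ^ (k - j) * s ^ j"
  have "(LINT x|std_normal_distribution. (scaled_hermite k s (m + s * x))\<^sup>2)
      = (LINT x|std_normal_distribution. (\<Sum>i\<le>k. \<Sum>j\<le>k. ?c i * ?c j * (poly (hermite i) x * poly (hermite j) x)))"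
    unfolding scaled_hermite_translate power2_eq_square sum_product by (simp add: mult_ac)
  also have "\<dots> = (\<Sum>i\<le>k. \<Sum>j\<le>k. ?c i * ?c j * (if i = j then fact i else 0))"
    by (simp add: Bochner_Integration.integral_sum hermite_orthogonal
        integrable_hermite_prod Bochner_Integration.integrable_sum)
  also have "\<dots> = (\<Sum>i\<le>k. \<Sum>j\<le>k. if i = j then ?c i * ?c j * fact i else 0)"
    by (intro sum.cong) auto
  also have "\<dots> = (\<Sum>i\<le>k. (?c i)\<^sup>2 * fact i)"
    by (simp add: power2_eq_square)
  finally show ?thesis .
qed

lemma power_le_fact_exp:
  assumes "0 \<le> (x::real)"
  shows "x ^ k \<le> fact k * exp x"
proof -
  have s: "summable (\<lambda>n. inverse (fact n) * x ^ n)"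
    by (rule summable_exp)
  have "(\<Sum>n\<in>{k}. inverse (fact n) * x ^ n) \<le> (\<Sum>n. inverse (fact n) * x ^ n)"
    using assms by (intro sum_le_suminf s) auto
  also have "\<dots> = exp x"
    by (simp add: exp_def scaleR_conv_of_real)
  finally show ?thesis
    by (simp add: field_simps)
qed

text \<open>
  Dividing the second moment by \<open>k!\<close> turns it into a binomial average, with weights
  \<open>s\<^sup>2\<close> and \<open>1 - s\<^sup>2\<close>, of the Taylor terms of \<open>exp (m\<^sup>2 / (1 - s\<^sup>2))\<close>.
\<close>
lemma integral_scaled_hermite_sq_le:
  assumes "s\<^sup>2 < 1"
  shows "(LINT x|std_normal_distribution. (scaled_hermite k s (m + s * x))\<^sup>2)
    \<le> fact k * exp (m\<^sup>2 / (1 - s\<^sup>2))"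
proof -
  define y where "y = m\<^sup>2 / (1 - s\<^sup>2)"
  have y: "0 \<le> y" "m\<^sup>2 = (1 - s\<^sup>2) * y"
    using assms by (auto simp: y_def)
  have "(of_nat (k choose j) * m ^ (k - j) * s ^ j)\<^sup>2 * fact j
     \<le> fact k * exp y * (of_nat (k choose j) * (s\<^sup>2) ^ j * (1 - s\<^sup>2) ^ (k - j))" if "j \<le> k" for j
  proof -
    \<comment> \<open>One of the two binomial coefficients in the square is spent on producing
      \<open>fact k\<close>; the other stays as the binomial weight.\<close>
    have f: "real (k choose j) * fact j * fact (k - j) = fact k"
      using that by (simp add: binomial_fact)
    have m: "(m ^ (k - j))\<^sup>2 = (1 - s\<^sup>2) ^ (k - j) * y ^ (k - j)"
      unfolding power_mult_distrib[symmetric] y(2)[symmetric] by (simp add: power_mult[symmetric] mult.commute)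
    have "(of_nat (k choose j) * m ^ (k - j) * s ^ j)\<^sup>2 * fact j
      = (of_nat (k choose j) * fact j * (of_nat (k choose j) * (s\<^sup>2) ^ j * (1 - s\<^sup>2) ^ (k - j))) * y ^ (k - j)"
      unfolding power_mult_distrib m by (simp add: power2_eq_square power_mult_distrib mult_ac)
    also have "\<dots> \<le> (of_nat (k choose j) * fact j * (of_nat (k choose j) * (s\<^sup>2) ^ j * (1 - s\<^sup>2) ^ (k - j))) * (fact (k - j) * exp y)"
      using assms y(1) by (intro mult_left_mono power_le_fact_exp mult_nonneg_nonneg zero_le_power[of "s\<^sup>2"] zero_le_power[of "1 - s\<^sup>2"]) auto
    also have "\<dots> = (real (k choose j) * fact j * fact (k - j)) * exp y * (of_nat (k choose j) * (s\<^sup>2) ^ j * (1 - s\<^sup>2) ^ (k - j))"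
      by (simp add: mult_ac)
    finally show ?thesis unfolding f .
  qed
  then have "(\<Sum>j\<le>k. (of_nat (k choose j) * m ^ (k - j) * s ^ j)\<^sup>2 * fact j)
     \<le> fact k * exp y * (\<Sum>j\<le>k. of_nat (k choose j) * (s\<^sup>2) ^ j * (1 - s\<^sup>2) ^ (k - j))"
    unfolding sum_distrib_left by (intro sum_mono) auto
  also have "(\<Sum>j\<le>k. of_nat (k choose j) * (s\<^sup>2) ^ j * (1 - s\<^sup>2) ^ (k - j)) = (s\<^sup>2 + (1 - s\<^sup>2)) ^ k"
    by (rule binomial_ring[symmetric])
  finally show ?thesis
    by (simp add: integral_scaled_hermite_sq y_def)
qed

section \<open>Normal tails and the Taylor series of \<open>G\<close>\<close>

text \<open>The sign \<open>e\<close> treats both tails at once. Shifting the half line to the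
  origin splits off \<open>exp (- t^2 / 2)\<close>, the cross term \<open>t * x\<close> being
  nonnegative there; what remains is bounded by the full mass.\<close>

lemma std_normal_tail:
  assumes "0 \<le> t" "\<bar>e\<bar> = 1"
  shows "measure std_normal_distribution {x. t \<le> e * x} \<le> exp (- t\<^sup>2 / 2)"
proof -
  have e: "e = 1 \<or> e = -1" using assms(2) by linarith
  have "emeasure std_normal_distribution {x. t \<le> e * x}
      = (\<integral>\<^sup>+x. ennreal (std_normal_density x) * indicator {x. t \<le> e * x} x \<partial>lborel)"
    by (rule emeasure_density) measurable
  also have "\<dots> = (\<integral>\<^sup>+x. ennreal (std_normal_density (e * t + e * x)) * indicator {x. t \<le> e * x} (e * t + e * x) \<partial>lborel)"
    using e by (subst nn_integral_real_affine[where t="e * t" and c=e]) auto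
  also have "\<dots> \<le> (\<integral>\<^sup>+x. ennreal (exp (- t\<^sup>2 / 2)) * ennreal (std_normal_density x) \<partial>lborel)"
  proof (intro nn_integral_mono)
    fix x :: real
    have "std_normal_density (e * t + e * x) \<le> exp (- t\<^sup>2 / 2) * std_normal_density x" if "0 \<le> x"
    proof -
      have "(e * t + e * x)\<^sup>2 = t\<^sup>2 + 2 * t * x + x\<^sup>2"
        using e by (auto simp: power2_eq_square algebra_simps)
      then have "- (e * t + e * x)\<^sup>2 / 2 \<le> - t\<^sup>2 / 2 + - x\<^sup>2 / 2"
        using assms(1) that by simp
      then have "exp (- (e * t + e * x)\<^sup>2 / 2) \<le> exp (- t\<^sup>2 / 2) * exp (- x\<^sup>2 / 2)"
        unfolding exp_add[symmetric] by simp
      then show ?thesis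
        by (simp add: std_normal_density_def divide_right_mono)
    qed
    moreover have "t \<le> e * (e * t + e * x) \<longleftrightarrow> 0 \<le> x"
      using e by auto
    ultimately show "ennreal (std_normal_density (e * t + e * x)) * indicator {x. t \<le> e * x} (e * t + e * x)
        \<le> ennreal (exp (- t\<^sup>2 / 2)) * ennreal (std_normal_density x)"
      by (auto simp: indicator_def ennreal_mult[symmetric] intro!: ennreal_leI)
  qed
  also have "\<dots> = ennreal (exp (- t\<^sup>2 / 2)) * emeasure std_normal_distribution UNIV"
    by (simp add: nn_integral_cmult emeasure_density)
  also have "emeasure std_normal_distribution UNIV = 1"
    using std_normal.emeasure_space_1 by simp
  finally show ?thesis
    by (simp add: std_normal.emeasure_eq_measure)
qed

text \<open>Covers the degenerate scale \<open>s = 0\<close>, reached at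
  \<open>\<tau> = \<infinity>\<close>: the event is then empty unless \<open>t = 0\<close>, where
  the bound is 1. Otherwise the bound after rescaling only grows when \<open>s\<close> becomes
  \<open>\<sigma>\<close>.\<close>

lemma std_normal_scaled_tail:
  assumes "0 \<le> s" "s \<le> \<sigma>" "0 < \<sigma>" "0 \<le> t" "\<bar>e\<bar> = 1"
  shows "measure std_normal_distribution {x. t \<le> e * (s * x)} \<le> exp (- t\<^sup>2 / (2 * \<sigma>\<^sup>2))"
proof (cases "s = 0")
  case True
  then show ?thesis
    using std_normal.prob_le_1[of UNIV] \<open>0 \<le> t\<close> by (cases "t = 0") auto
next
  case False
  with assms have "s > 0" by simp
  then have "{x. t \<le> e * (s * x)} = {x. t / s \<le> e * x}"
    by (auto simp: field_simps)
  then have "measure std_normal_distribution {x. t \<le> e * (s * x)} \<le> exp (- (t / s)\<^sup>2 / 2)"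
    using std_normal_tail[of "t / s" e] assms \<open>s > 0\<close> by simp
  also have "(t / \<sigma>)\<^sup>2 \<le> (t / s)\<^sup>2"
    using assms \<open>s > 0\<close> by (intro power_mono divide_left_mono) auto
  then have "exp (- (t / s)\<^sup>2 / 2) \<le> exp (- t\<^sup>2 / (2 * \<sigma>\<^sup>2))"
    by (simp add: power_divide)
  finally show ?thesis .
qed

lemma Phi_nonneg: "0 \<le> Phi x" and Phi_le_1: "Phi x \<le> 1"
  by (simp_all add: std_normal.cdf_nonneg std_normal.cdf_bounded_prob)

lemma Phi_tail_le: "x \<le> 0 \<Longrightarrow> Phi x \<le> exp (- x\<^sup>2 / 2)"
  using std_normal_tail[of "- x" "-1"] by (simp add: cdf_def atMost_def)

lemma Phi_upper_tail_le: "0 \<le> x \<Longrightarrow> 1 - Phi x \<le> exp (- x\<^sup>2 / 2)"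
proof -
  assume "0 \<le> x"
  have "1 - Phi x = measure std_normal_distribution {x<..}"
  proof -
    have "{x<..} = UNIV - {..x}" by auto
    then show ?thesis
      using std_normal.prob_compl[of "{..x}"] by (simp add: cdf_def)
  qed
  also have "\<dots> \<le> measure std_normal_distribution {y. x \<le> 1 * y}"
    by (intro std_normal.finite_measure_mono) auto
  also have "\<dots> \<le> exp (- x\<^sup>2 / 2)"
    using \<open>0 \<le> x\<close> by (intro std_normal_tail) auto
  finally show ?thesis .
qed

section \<open>Derivatives and power series of \<open>Phi\<close>, the normal density and
  \<open>G\<close>\<close>

lemma Phi_has_real_derivative: "(Phi has_real_derivative std_normal_density x) (at x)"
proof -
  define a where "a = x - 1"
  define b where "b = x + 1"
  have cont: "continuous_on S std_normal_density" for S
    unfolding std_normal_density_def by (intro continuous_intros) auto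
  \<comment> \<open>On a window around \<open>x\<close>, \<open>Phi\<close> is a constant plus the
    integral of a continuous density, so the fundamental theorem of calculus applies.\<close>
  have eq: "Phi y = Phi a + integral {a..y} std_normal_density" if "y \<in> {a..b}" for y
  proof -
    have "measure std_normal_distribution {a<..y} = Phi y - Phi a"
    proof (cases "a = y")
      case False
      then show ?thesis using that std_normal.cdf_diff_eq[of a y] by auto
    qed simp
    moreover have "measure std_normal_distribution {a<..y} = integral {a..y} std_normal_density"
    proof -
      have "measure std_normal_distribution {a<..y} = (LINT t|std_normal_distribution. indicator {a<..y} t)"
        by simp
      also have "\<dots> = (LINT t:{a<..y}|lborel. std_normal_density t)"
        unfolding set_lebesgue_integral_def by (subst integral_real_density) (auto simp: mult.commute)
      also have "\<dots> = integral {a<..y} std_normal_density"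
        using integrable_mult_indicator[of "{a<..y}" lborel std_normal_density]
        by (intro set_borel_integral_eq_integral(2)) (simp add: set_integrable_def)
      also have "\<dots> = integral {a..y} std_normal_density"
        by (rule integral_spike_set) (auto intro: negligible_subset[of "{a}"])
      finally show ?thesis .
    qed
    ultimately show ?thesis by simp
  qed
  have "((\<lambda>y. integral {a..y} std_normal_density) has_real_derivative std_normal_density x) (at x within {a..b})"
    by (rule integral_has_real_derivative[OF cont]) (auto simp: a_def b_def)
  then have "((\<lambda>y. Phi a + integral {a..y} std_normal_density) has_real_derivative std_normal_density x) (at x within {a..b})"
    by (auto intro!: derivative_eq_intros)
  then have "(Phi has_real_derivative std_normal_density x) (at x within {a..b})"
    by (rule has_field_derivative_transform_within[of _ _ _ _ 1])
       (simp_all only: eq[symmetric], simp_all add: a_def b_def)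
  then show ?thesis
    by (subst (asm) at_within_interior) (auto simp: a_def b_def)
qed

lemma std_normal_density_has_real_derivative:
  "(std_normal_density has_real_derivative - x * std_normal_density x) (at x)"
  unfolding std_normal_density_def[abs_def]
  by (auto intro!: derivative_eq_intros simp: field_simps)

lemma G_has_real_derivative: "((\<lambda>w. G w \<beta>) has_real_derivative Phi w - \<beta>) (at w)"
  unfolding G_def
  by (auto intro!: derivative_eq_intros Phi_has_real_derivative std_normal_density_has_real_derivative)

text \<open>Taylor coefficients of \<open>G\<close> at 0. Its second derivative is the normal
  density, whose derivatives at 0 are Hermite values up to sign; \<open>(-1) ^ k\<close> agrees with
  \<open>(-1) ^ (k - 2)\<close>.\<close>

definition G_coeff :: "real \<Rightarrow> nat \<Rightarrow> real" where
  "G_coeff \<beta> k =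
    (if k = 0 then G 0 \<beta> else if k = 1 then Phi 0 - \<beta>
     else std_normal_density 0 * ((-1) ^ k * poly (hermite (k - 2)) 0 / fact k))"

lemma std_normal_density_le_exp: "std_normal_density x \<le> exp (- x\<^sup>2 / 2)"
proof -
  have "1 / sqrt (2 * pi) \<le> 1"
    using pi_gt3 by simp
  then have "1 / sqrt (2 * pi) * exp (- x\<^sup>2 / 2) \<le> 1 * exp (- x\<^sup>2 / 2)"
    by (rule mult_right_mono) simp
  then show ?thesis by (simp add: std_normal_density_def)
qed

text \<open>The weight \<open>fact k\<close> is the factorial growth in the second moment bound for
  the rescaled polynomial of degree \<open>k\<close>, so the two cancel in every term of the
  series.\<close>

lemma G_coeff_sq_le:
  assumes "0 < \<beta>" "\<beta> < 1"
  shows "(G_coeff \<beta> k)\<^sup>2 * fact k \<le> 1"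
proof -
  have d: "0 \<le> std_normal_density 0" "std_normal_density 0 \<le> 1"
    using std_normal_density_le_exp[of 0] by auto
  consider "k = 0" | "k = 1" | j where "k = Suc (Suc j)"
    by (metis One_nat_def nat.exhaust)
  then show ?thesis
  proof cases
    case 1
    then show ?thesis using d by (simp add: G_coeff_def G_def power_le_one)
  next
    case 2
    then show ?thesis
      using assms Phi_nonneg[of 0] Phi_le_1[of 0] by (simp add: G_coeff_def abs_square_le_1)
  next
    case 3
    have "(G_coeff \<beta> k)\<^sup>2 * fact k = (std_normal_density 0)\<^sup>2 * ((poly (hermite j) 0)\<^sup>2 / fact k)"
      using 3 by (simp add: G_coeff_def power_mult_distrib power_divide power2_eq_square del: fact_Suc)
    also have "\<dots> \<le> 1 * (fact k / fact k)"
    proof (intro mult_mono divide_right_mono)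
      have "(poly (hermite j) 0)\<^sup>2 \<le> fact j" by (rule poly_hermite_0_sq_le)
      also have "(fact j :: real) \<le> fact k" using 3 by (intro fact_mono) auto
      finally show "(poly (hermite j) 0)\<^sup>2 \<le> fact k" .
    qed (use d in \<open>auto simp: power_le_one\<close>)
    finally show ?thesis by simp
  qed
qed

lemma summable_G_coeff:
  assumes "0 < \<beta>" "\<beta> < 1"
  shows "summable (\<lambda>k. G_coeff \<beta> k * w ^ k)"
proof (rule summable_comparison_test)
  have "norm (G_coeff \<beta> k * w ^ k) \<le> sqrt (exp (4 * w\<^sup>2)) * (1 / 2) ^ k" for k
  proof (rule power2_le_imp_le)
    \<comment> \<open>Working with \<open>(2 * w)^2\<close> instead of \<open>w^2\<close> buys the
      geometric ratio 1/2.\<close>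
    have "(G_coeff \<beta> k)\<^sup>2 * (4 * w\<^sup>2) ^ k \<le> (G_coeff \<beta> k)\<^sup>2 * (fact k * exp (4 * w\<^sup>2))"
      by (intro mult_left_mono power_le_fact_exp) auto
    also have "\<dots> = (G_coeff \<beta> k)\<^sup>2 * fact k * exp (4 * w\<^sup>2)" by simp
    also have "\<dots> \<le> 1 * exp (4 * w\<^sup>2)"
      by (intro mult_right_mono G_coeff_sq_le assms) auto
    finally have "(G_coeff \<beta> k)\<^sup>2 * (4 * w\<^sup>2) ^ k \<le> exp (4 * w\<^sup>2)" by simp
    moreover have "(4 * w\<^sup>2) ^ k = (2 ^ k * w ^ k)\<^sup>2"
    proof -
      have "((2 * w)\<^sup>2) ^ k = ((2 * w) ^ k)\<^sup>2"
        by (simp only: power_mult[symmetric] mult.commute)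
      then show ?thesis by (simp only: power_mult_distrib) simp
    qed
    moreover have "(G_coeff \<beta> k)\<^sup>2 * (2 ^ k * w ^ k)\<^sup>2 = (G_coeff \<beta> k * w ^ k)\<^sup>2 * (2 ^ k)\<^sup>2"
      by (simp only: power_mult_distrib mult_ac)
    ultimately have "(G_coeff \<beta> k * w ^ k)\<^sup>2 * (2 ^ k)\<^sup>2 \<le> exp (4 * w\<^sup>2)"
      by (simp only:)
    then have "(G_coeff \<beta> k * w ^ k)\<^sup>2 \<le> exp (4 * w\<^sup>2) * (1 / (2 ^ k)\<^sup>2)"
      by (simp only: times_divide_eq_right mult_1_right) (subst pos_le_divide_eq, auto)
    moreover have "(sqrt (exp (4 * w\<^sup>2)) * (1 / 2) ^ k)\<^sup>2 = exp (4 * w\<^sup>2) * (1 / (2 ^ k)\<^sup>2)"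
      by (simp only: power_mult_distrib power_one_over real_sqrt_pow2 exp_ge_zero)
    ultimately show "(norm (G_coeff \<beta> k * w ^ k))\<^sup>2 \<le> (sqrt (exp (4 * w\<^sup>2)) * (1 / 2) ^ k)\<^sup>2"
      by (simp only: real_norm_def power2_abs)
  qed simp
  then show "\<exists>N. \<forall>k\<ge>N. norm (G_coeff \<beta> k * w ^ k) \<le> sqrt (exp (4 * w\<^sup>2)) * (1 / 2) ^ k"
    by blast
  show "summable (\<lambda>k. sqrt (exp (4 * w\<^sup>2)) * (1 / 2) ^ k)"
    by (intro summable_mult summable_geometric) simp
qed

text \<open>Odd Hermite values at 0 vanish, and the even ones turn the series into the exponential
  series of \<open>- w^2 / 2\<close>.\<close>

lemma std_normal_density_sums:
  "(\<lambda>n. std_normal_density 0 * ((-1) ^ n * poly (hermite n) 0 / fact n) * w ^ n) sums std_normal_density w"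
    (is "?f sums _")
proof -
  have even: "?f (2 * m) = std_normal_density 0 * ((- w\<^sup>2 / 2) ^ m /\<^sub>R fact m)" for m
  proof -
    have "(- w\<^sup>2 / 2) ^ m = (-1) ^ m * w ^ (2 * m) / 2 ^ m"
      by (simp add: power_divide power_mult power_minus[of "w\<^sup>2 / 2"])
    then show ?thesis
      unfolding poly_hermite_0_even by (simp add: field_simps)
  qed
  have "(\<lambda>m. std_normal_density 0 * ((- w\<^sup>2 / 2) ^ m /\<^sub>R fact m)) sums (std_normal_density 0 * exp (- w\<^sup>2 / 2))"
    by (intro sums_mult exp_converges)
  also have "std_normal_density 0 * exp (- w\<^sup>2 / 2) = std_normal_density w"
    by (simp add: std_normal_density_def)
  finally have "(\<lambda>m. ?f (2 * m)) sums std_normal_density w"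
    unfolding even .
  moreover have "?f n = 0" if "n \<notin> range ((*) 2)" for n
  proof -
    have "odd n" using that by (auto elim!: evenE)
    then show ?thesis by (elim oddE) (simp add: poly_hermite_0_odd del: hermite.simps(2))
  qed
  ultimately show ?thesis
    by (subst (asm) sums_mono_reindex) (auto simp: strict_mono_def)
qed

text \<open>Differentiating the power series twice gives the density series. Going back up, first
  the derivatives and then the functions differ by a constant, which agreement at 0 makes
  zero.\<close>

lemma G_sums:
  assumes "0 < \<beta>" "\<beta> < 1"
  shows "(\<lambda>k. G_coeff \<beta> k * w ^ k) sums G w \<beta>"
proof -
  let ?F = "\<lambda>w. \<Sum>k. G_coeff \<beta> k * w ^ k"
  let ?F1 = "\<lambda>w. \<Sum>k. diffs (G_coeff \<beta>) k * w ^ k"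
  let ?F2 = "\<lambda>w. \<Sum>k. diffs (diffs (G_coeff \<beta>)) k * w ^ k"
  note s = summable_G_coeff[OF assms]
  have s1: "summable (\<lambda>k. diffs (G_coeff \<beta>) k * w ^ k)" for w
    by (rule termdiff_converges_all[OF s])
  have F: "(?F has_real_derivative ?F1 w) (at w)" for w
    by (rule termdiffs_strong_converges_everywhere[OF s])
  have F1: "(?F1 has_real_derivative ?F2 w) (at w)" for w
    by (rule termdiffs_strong_converges_everywhere[OF s1])
  have "diffs (diffs (G_coeff \<beta>)) n = std_normal_density 0 * ((-1) ^ n * poly (hermite n) 0 / fact n)" for n
  proof -
    have "fact (Suc (Suc n)) = real (Suc n) * real (Suc (Suc n)) * fact n"
      by (simp add: algebra_simps)
    then show ?thesis
      by (simp add: diffs_def G_coeff_def del: fact_Suc of_nat_Suc)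
  qed
  then have F2: "?F2 w = std_normal_density w" for w
    using std_normal_density_sums[of w] by (simp add: sums_unique[symmetric])
  have F1_eq: "?F1 w = Phi w - \<beta>" for w
  proof -
    have "(\<lambda>w. Phi w - \<beta> - ?F1 w) w = (\<lambda>w. Phi w - \<beta> - ?F1 w) 0"
    proof (rule DERIV_isconst_all[of "\<lambda>w. Phi w - \<beta> - ?F1 w"], rule allI)
      show "((\<lambda>w. Phi w - \<beta> - ?F1 w) has_real_derivative 0) (at x)" for x
        using F1[of x] unfolding F2
        by (auto intro!: derivative_eq_intros Phi_has_real_derivative)
    qed
    moreover have "?F1 0 = Phi 0 - \<beta>"
      by (simp add: diffs_def G_coeff_def)
    ultimately show ?thesis by simp
  qed
  have "(\<lambda>w. G w \<beta> - ?F w) w = (\<lambda>w. G w \<beta> - ?F w) 0"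
  proof (rule DERIV_isconst_all[of "\<lambda>w. G w \<beta> - ?F w"], rule allI)
    show "((\<lambda>w. G w \<beta> - ?F w) has_real_derivative 0) (at x)" for x
      using F[of x] unfolding F1_eq
      by (auto intro!: derivative_eq_intros G_has_real_derivative)
  qed
  moreover have "?F 0 = G 0 \<beta>"
    by (simp add: G_coeff_def)
  ultimately have "?F w = G w \<beta>" by simp
  then show ?thesis
    using summable_sums[OF s[of w]] by simp
qed

section \<open>The truncated Hermite series\<close>

definition S_sum :: "real \<Rightarrow> nat \<Rightarrow> real \<Rightarrow> real \<Rightarrow> real" where
  "S_sum \<beta> K s u = (\<Sum>k\<le>K. G_coeff \<beta> k * scaled_hermite k s u)"

definition clip :: "real \<Rightarrow> real \<Rightarrow> real" where
  "clip N y = sgn y * min \<bar>y\<bar> N"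

text \<open>The constant and linear terms join the sum, since the rescaled polynomials of degree 0
  and 1 are 1 and \<open>u\<close>.\<close>

lemma S_series_eq_S_sum:
  "S_series vp vf \<beta> g n \<tau> u = S_sum \<beta> (K_order vp vf g n) (s_scale vp vf \<tau>) u"
proof -
  let ?s = "s_scale vp vf \<tau>"
  let ?f = "\<lambda>k. G_coeff \<beta> k * scaled_hermite k ?s u"
  \<comment> \<open>The sum over \<open>k < j\<close> reaches degree \<open>j + 1\<close>, which is
    exactly \<open>K_order\<close>.\<close>
  obtain j where K: "K_order vp vf g n = Suc j"
    by (simp add: K_order_def)
  have d: "deriv (\<lambda>w. G w \<beta>) 0 = Phi 0 - \<beta>"
    by (rule DERIV_imp_deriv[OF G_has_real_derivative])
  have s01: "scaled_hermite 0 ?s u = 1" "scaled_hermite (Suc 0) ?s u = u"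
    by (simp_all add: scaled_hermite_def)
  have "(\<Sum>k\<le>Suc j. ?f k) = ?f 0 + ?f (Suc 0) + (\<Sum>k<j. ?f (Suc (Suc k)))"
    by (simp only: lessThan_Suc_atMost[symmetric] sum.lessThan_Suc_shift add_ac)
  also have "(\<Sum>k<j. ?f (Suc (Suc k))) = std_normal_density 0 *
      (\<Sum>k<j. (-1) ^ k * poly (hermite k) 0 / fact (k + 2) * scaled_hermite (k + 2) ?s u)"
    by (simp add: G_coeff_def sum_distrib_left mult_ac del: fact_Suc)
  finally show ?thesis
    unfolding S_series_def S_sum_def K d using s01 by (simp add: G_coeff_def)
qed

lemma abs_clip_le: "0 \<le> N \<Longrightarrow> \<bar>clip N y\<bar> \<le> N" "0 \<le> N \<Longrightarrow> \<bar>clip N y\<bar> \<le> \<bar>y\<bar>"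
  by (auto simp: clip_def abs_mult sgn_if)

text \<open>Where clipping acts, \<open>\<bar>y\<bar>\<close> exceeds \<open>N\<close>, so an error
  of at most \<open>\<bar>y\<bar>\<close> is at most \<open>y^2 / N\<close>. A second moment thus
  controls the bias due to clipping.\<close>

lemma abs_diff_clip_le: "0 < N \<Longrightarrow> \<bar>clip N y - y\<bar> \<le> y\<^sup>2 / N"
proof (cases "\<bar>y\<bar> \<le> N")
  case True
  then show "0 < N \<Longrightarrow> \<bar>clip N y - y\<bar> \<le> y\<^sup>2 / N"
    by (auto simp: clip_def sgn_if)
next
  case False
  assume "0 < N"
  then have "\<bar>clip N y - y\<bar> \<le> \<bar>y\<bar>"
    using False by (auto simp: clip_def sgn_if)
  also have "\<bar>y\<bar> * N \<le> \<bar>y\<bar> * \<bar>y\<bar>"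
    using False by (intro mult_left_mono) auto
  then have "\<bar>y\<bar> \<le> y\<^sup>2 / N"
    using \<open>0 < N\<close> by (simp add: field_simps power2_eq_square)
  finally show ?thesis .
qed

lemma clip_measurable[measurable]: "clip N \<in> borel_measurable borel"
  unfolding clip_def[abs_def] by measurable

lemma scaled_hermite_measurable[measurable]: "scaled_hermite k s \<in> borel_measurable borel"
proof (cases "s = 0")
  case True
  then have "scaled_hermite k s = (\<lambda>u. u ^ k)" by (auto simp: scaled_hermite_def)
  then show ?thesis by simp
next
  case False
  then have "scaled_hermite k s = (\<lambda>u. s ^ k * poly (hermite k) (u / s))" by (auto simp: scaled_hermite_def)
  then show ?thesis
    by (auto intro!: borel_measurable_continuous_onI continuous_intros simp: False)
qed

lemma S_sum_measurable[measurable]: "S_sum \<beta> K s \<in> borel_measurable borel"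
  unfolding S_sum_def[abs_def] by measurable

lemma integrable_scaled_hermite:
  "integrable std_normal_distribution (\<lambda>x. scaled_hermite k s (m + s * x))"
  "integrable std_normal_distribution (\<lambda>x. (scaled_hermite k s (m + s * x))\<^sup>2)"
proof -
  obtain p where p: "\<And>x. scaled_hermite k s (m + s * x) = poly p x"
    using scaled_hermite_eq_poly[of k s m] by blast
  show "integrable std_normal_distribution (\<lambda>x. scaled_hermite k s (m + s * x))"
    by (rule integrable_std_normal_polyI[of _ p]) (rule p)
  show "integrable std_normal_distribution (\<lambda>x. (scaled_hermite k s (m + s * x))\<^sup>2)"
    by (rule integrable_std_normal_polyI[of _ "p ^ 2"]) (simp add: p)
qed

lemma integrable_S_sum:
  "integrable std_normal_distribution (\<lambda>x. S_sum \<beta> K s (m + s * x))"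
  "integrable std_normal_distribution (\<lambda>x. (S_sum \<beta> K s (m + s * x))\<^sup>2)"
proof -
  have "\<exists>p. \<forall>k x. scaled_hermite k s (m + s * x) = poly (p k) x"
    using scaled_hermite_eq_poly[of _ s m] by metis
  then obtain p where p: "\<And>k x. scaled_hermite k s (m + s * x) = poly (p k) x"
    by blast
  have S: "S_sum \<beta> K s (m + s * x) = poly (\<Sum>k\<le>K. smult (G_coeff \<beta> k) (p k)) x" for x
    by (simp add: S_sum_def p poly_sum)
  show "integrable std_normal_distribution (\<lambda>x. S_sum \<beta> K s (m + s * x))"
    by (rule integrable_std_normal_polyI) (rule S)
  show "integrable std_normal_distribution (\<lambda>x. (S_sum \<beta> K s (m + s * x))\<^sup>2)"
    by (rule integrable_std_normal_polyI[of _ "(\<Sum>k\<le>K. smult (G_coeff \<beta> k) (p k)) ^ 2"]) (simp add: S)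
qed

lemma integral_S_sum:
  "(LINT x|std_normal_distribution. S_sum \<beta> K s (m + s * x)) = (\<Sum>k\<le>K. G_coeff \<beta> k * m ^ k)"
  unfolding S_sum_def
  by (subst Bochner_Integration.integral_sum)
     (auto intro!: integrable_mult_right integrable_scaled_hermite simp: integral_scaled_hermite)

text \<open>Cauchy-Schwarz over the \<open>K + 1\<close> terms reduces to single polynomials, which
  need not be mutually orthogonal when \<open>m\<close> is nonzero. The coefficient bound then
  cancels the factorials.\<close>

lemma integral_S_sum_sq_le:
  assumes "0 < \<beta>" "\<beta> < 1" "s\<^sup>2 < 1"
  shows "(LINT x|std_normal_distribution. (S_sum \<beta> K s (m + s * x))\<^sup>2)
    \<le> (real K + 1)\<^sup>2 * exp (m\<^sup>2 / (1 - s\<^sup>2))"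
proof -
  let ?h = "\<lambda>k x. scaled_hermite k s (m + s * x)"
  let ?E = "exp (m\<^sup>2 / (1 - s\<^sup>2))"
  have "(LINT x|std_normal_distribution. (S_sum \<beta> K s (m + s * x))\<^sup>2)
    \<le> (LINT x|std_normal_distribution. (real K + 1) * (\<Sum>k\<le>K. (G_coeff \<beta> k)\<^sup>2 * (?h k x)\<^sup>2))"
  proof (rule integral_mono)
    show "integrable std_normal_distribution (\<lambda>x. (real K + 1) * (\<Sum>k\<le>K. (G_coeff \<beta> k)\<^sup>2 * (?h k x)\<^sup>2))"
      by (intro integrable_mult_right Bochner_Integration.integrable_sum integrable_scaled_hermite)
    fix x
    have "(\<Sum>k\<le>K. G_coeff \<beta> k * ?h k x)\<^sup>2 \<le> (\<Sum>k\<le>K. (G_coeff \<beta> k * ?h k x)\<^sup>2) * real (card {..K})"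
      by (rule sum_squared_le_sum_of_squares)
    then show "(S_sum \<beta> K s (m + s * x))\<^sup>2 \<le> (real K + 1) * (\<Sum>k\<le>K. (G_coeff \<beta> k)\<^sup>2 * (?h k x)\<^sup>2)"
      by (simp add: S_sum_def power_mult_distrib mult.commute add.commute)
  qed (rule integrable_S_sum)
  also have "\<dots> = (real K + 1) * (\<Sum>k\<le>K. (G_coeff \<beta> k)\<^sup>2 * (LINT x|std_normal_distribution. (?h k x)\<^sup>2))"
    by (simp add: integrable_scaled_hermite Bochner_Integration.integral_sum)
  also have "\<dots> \<le> (real K + 1) * (\<Sum>k\<le>K. ?E)"
  proof (intro mult_left_mono sum_mono)
    fix k
    have "(G_coeff \<beta> k)\<^sup>2 * (LINT x|std_normal_distribution. (?h k x)\<^sup>2) \<le> (G_coeff \<beta> k)\<^sup>2 * (fact k * ?E)"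
      by (intro mult_left_mono integral_scaled_hermite_sq_le assms) auto
    also have "\<dots> = ((G_coeff \<beta> k)\<^sup>2 * fact k) * ?E" by simp
    also have "\<dots> \<le> 1 * ?E"
      by (intro mult_right_mono G_coeff_sq_le assms) auto
    finally show "(G_coeff \<beta> k)\<^sup>2 * (LINT x|std_normal_distribution. (?h k x)\<^sup>2) \<le> ?E" by simp
  qed auto
  also have "\<dots> = (real K + 1)\<^sup>2 * ?E"
    by (simp add: power2_eq_square algebra_simps)
  finally show ?thesis .
qed

text \<open>From \<open>k^k \<le> k! * e^k\<close>, the hypothesis bounds the term of each order
  \<open>k \<ge> K\<close> by \<open>(6 / 7) ^ k\<close>; the constant 7 is the sum of the geometric
  series.\<close>

lemma G_Taylor_remainder:
  assumes \<beta>: "0 < \<beta>" "\<beta> < 1" and K: "exp 1 * m\<^sup>2 \<le> (6 / 7)\<^sup>2 * real K" "0 < K"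
  shows "\<bar>(\<Sum>k\<le>K. G_coeff \<beta> k * m ^ k) - G m \<beta>\<bar> \<le> 7 * (6 / 7) ^ K"
proof -
  have bound: "\<bar>G_coeff \<beta> k * m ^ k\<bar> \<le> (6 / 7) ^ k" if "K \<le> k" for k
  proof (rule power2_le_imp_le)
    have "exp 1 * m\<^sup>2 \<le> (6 / 7)\<^sup>2 * real k"
      using K(1) that by (elim order_trans) simp
    then have "m\<^sup>2 \<le> (6 / 7)\<^sup>2 * (real k / exp 1)"
      by (simp add: field_simps)
    then have "(m\<^sup>2) ^ k \<le> ((6 / 7)\<^sup>2 * (real k / exp 1)) ^ k"
      by (rule power_mono) simp
    also have "\<dots> = ((6 / 7)\<^sup>2) ^ k * (real k ^ k / exp (real k))"
      using exp_of_nat_mult[of k "1::real"] by (simp only: power_mult_distrib power_divide mult_1_right)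
    also have "\<dots> \<le> ((6 / 7)\<^sup>2) ^ k * fact k"
      using power_le_fact_exp[of "real k" k] by (intro mult_left_mono) (auto simp: field_simps)
    finally have "(G_coeff \<beta> k)\<^sup>2 * (m\<^sup>2) ^ k \<le> (G_coeff \<beta> k)\<^sup>2 * (((6 / 7)\<^sup>2) ^ k * fact k)"
      by (rule mult_left_mono) simp
    also have "\<dots> = ((G_coeff \<beta> k)\<^sup>2 * fact k) * ((6 / 7)\<^sup>2) ^ k" by simp
    also have "\<dots> \<le> 1 * ((6 / 7)\<^sup>2) ^ k"
      by (intro mult_right_mono G_coeff_sq_le \<beta>) auto
    finally show "\<bar>G_coeff \<beta> k * m ^ k\<bar>\<^sup>2 \<le> ((6 / 7) ^ k)\<^sup>2"
      by (simp only: power2_abs power_mult_distrib power_mult[symmetric]) (simp add: mult.commute)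
  qed simp
  let ?f = "\<lambda>k. G_coeff \<beta> k * m ^ k"
  have s: "summable (\<lambda>k. (6 / 7 :: real) ^ (k + K))"
    by (simp add: power_add summable_mult2 summable_geometric)
  have le: "norm (?f (k + K + 1)) \<le> (6 / 7) ^ (k + K)" for k
  proof -
    \<comment> \<open>The remainder starts at order \<open>K + 1\<close>; one factor 6/7 is given up
      for a simpler bound.\<close>
    have "norm (?f (k + K + 1)) \<le> (6 / 7) ^ (k + K + 1)" using bound[of "k + K + 1"] by simp
    also have "\<dots> \<le> (6 / 7) ^ (k + K)" by (rule power_decreasing) auto
    finally show ?thesis .
  qed
  have "G m \<beta> = (\<Sum>k. ?f k)"
    using G_sums[OF \<beta>] by (simp add: sums_iff)
  also have "\<dots> = (\<Sum>k. ?f (k + (K + 1))) + (\<Sum>k<K + 1. ?f k)"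
    using G_sums[OF \<beta>] by (intro suminf_split_initial_segment) (auto simp: sums_iff)
  finally have "\<bar>(\<Sum>k\<le>K. ?f k) - G m \<beta>\<bar> = norm (\<Sum>k. ?f (k + K + 1))"
    by (simp add: lessThan_Suc_atMost add.assoc)
  also have "\<dots> \<le> (\<Sum>k. (6 / 7) ^ (k + K))"
    by (rule norm_suminf_le[OF le s])
  also have "\<dots> = (\<Sum>k. (6 / 7) ^ k) * (6 / 7) ^ K"
    unfolding power_add by (intro suminf_mult2[symmetric] summable_geometric) simp
  also have "(\<Sum>k. (6 / 7 :: real) ^ k) = 7"
    by (subst suminf_geometric) auto
  finally show ?thesis .
qed

section \<open>Branch errors and branch probabilities\<close>

lemma tail_product_le:
  fixes q w m \<Lambda> :: real
  assumes "0 \<le> q" "q \<le> 1" "0 \<le> \<Lambda>"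
    and q: "0 \<le> \<Lambda> + m \<Longrightarrow> q \<le> exp (- (\<Lambda> + m)\<^sup>2 / 2)"
    and w: "\<bar>w\<bar> \<le> 1 + \<bar>m\<bar>" "m \<le> 0 \<Longrightarrow> \<bar>w\<bar> \<le> (1 + \<bar>m\<bar>) * exp (- m\<^sup>2 / 2)"
  shows "q * \<bar>w\<bar> \<le> 2 * exp (- \<Lambda>\<^sup>2 / 16)"
proof -
  \<comment> \<open>The linear factor costs half of the Gaussian exponent; the other half,
    \<open>y^2 / 4\<close>, is at least \<open>\<Lambda>^2 / 16\<close>.\<close>
  have main: "(1 + y) * exp (- y\<^sup>2 / 2) \<le> 2 * exp (- \<Lambda>\<^sup>2 / 16)" if "\<Lambda> / 2 \<le> y" for y
  proof -
    have "0 \<le> (y - 1)\<^sup>2" by simp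
    then have "1 + y \<le> 2 * (1 + y\<^sup>2 / 4)"
      by (simp add: power2_eq_square algebra_simps)
    also have "\<dots> \<le> 2 * exp (y\<^sup>2 / 4)"
      by (intro mult_left_mono exp_ge_add_one_self) simp
    finally have "(1 + y) * exp (- y\<^sup>2 / 2) \<le> 2 * exp (y\<^sup>2 / 4) * exp (- y\<^sup>2 / 2)"
      by (rule mult_right_mono) simp
    also have "\<dots> = 2 * exp (- y\<^sup>2 / 4)"
      by (simp flip: exp_add)
    also have "(\<Lambda> / 2)\<^sup>2 \<le> y\<^sup>2"
      using that assms(3) by (intro power_mono) auto
    then have "exp (- y\<^sup>2 / 4) \<le> exp (- \<Lambda>\<^sup>2 / 16)"
      by (simp add: power_divide)
    finally show ?thesis by simp
  qed
  show ?thesis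
  \<comment> \<open>Left of the midpoint between \<open>- \<Lambda>\<close> and 0 the branch error
    \<open>w\<close> is Gaussian small. Right of it the branch probability \<open>q\<close> is, and
    there \<open>\<bar>m\<bar> \<le> \<Lambda> + m\<close>.\<close>
  proof (cases "m \<le> - \<Lambda> / 2")
    case True
    then have "m \<le> 0" using assms(3) by simp
    have "q * \<bar>w\<bar> \<le> 1 * ((1 + \<bar>m\<bar>) * exp (- m\<^sup>2 / 2))"
      using assms w(2)[OF \<open>m \<le> 0\<close>] by (intro mult_mono) auto
    also have "\<dots> \<le> 2 * exp (- \<Lambda>\<^sup>2 / 16)"
      using main[of "\<bar>m\<bar>"] True \<open>m \<le> 0\<close> by simp
    finally show ?thesis .
  next
    case False
    have "q * \<bar>w\<bar> \<le> exp (- (\<Lambda> + m)\<^sup>2 / 2) * (1 + (\<Lambda> + m))"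
      using False assms(1,3) w(1) by (intro mult_mono q) auto
    also have "\<dots> \<le> 2 * exp (- \<Lambda>\<^sup>2 / 16)"
      using main[of "\<Lambda> + m"] False by (simp add: mult.commute)
    finally show ?thesis .
  qed
qed

text \<open>The tail exponent \<open>t^2 / (2 * \<sigma>^2)\<close> is shared out: three quarters
  give \<open>4 / 3 * l\<close>, as 3/4 times 16/9 is 4/3, and the last quarter absorbs the
  polynomial weight in \<open>m\<close>.\<close>

lemma middle_prob_far_le:
  assumes s: "0 \<le> s" "s \<le> \<sigma>" "0 < \<sigma>" "\<sigma> \<le> 1" and "0 \<le> \<Lambda>" "0 \<le> l"
    and m: "\<Lambda> + 4 / 3 * \<sigma> * sqrt (2 * l) \<le> \<bar>m\<bar>"
  shows "measure std_normal_distribution {x. \<bar>m + s * x\<bar> \<le> \<Lambda>} * (1 + \<bar>m\<bar>)\<^sup>2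
    \<le> 64 * (1 + \<Lambda>)\<^sup>2 * exp (- (4 / 3) * l)"
proof -
  define t where "t = \<bar>m\<bar> - \<Lambda>"
  have t: "4 / 3 * \<sigma> * sqrt (2 * l) \<le> t" "0 \<le> t"
  proof -
    show "4 / 3 * \<sigma> * sqrt (2 * l) \<le> t" using m by (simp add: t_def)
    moreover have "0 \<le> 4 / 3 * \<sigma> * sqrt (2 * l)" using assms by simp
    ultimately show "0 \<le> t" by linarith
  qed
  \<comment> \<open>To reach the middle interval the noise must move by at least \<open>t\<close>
    towards the origin; the sign selects that tail.\<close>
  have "measure std_normal_distribution {x. \<bar>m + s * x\<bar> \<le> \<Lambda>}
    \<le> measure std_normal_distribution {x. t \<le> (if 0 \<le> m then - 1 else 1) * (s * x)}"
    by (intro std_normal.finite_measure_mono) (auto simp: t_def)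
  also have "\<dots> \<le> exp (- t\<^sup>2 / (2 * \<sigma>\<^sup>2))"
    using s t by (intro std_normal_scaled_tail) auto
  also have "\<dots> \<le> exp (- (4 / 3) * l) * exp (- t\<^sup>2 / 8)"
  proof -
    have "(4 / 3 * \<sigma> * sqrt (2 * l))\<^sup>2 \<le> t\<^sup>2"
      using t assms by (intro power_mono) auto
    then have 1: "32 / 9 * l * \<sigma>\<^sup>2 \<le> t\<^sup>2"
      using assms by (simp add: power_mult_distrib power_divide) (simp add: field_simps)
    have 2: "t\<^sup>2 * \<sigma>\<^sup>2 \<le> t\<^sup>2"
      using s by (intro mult_left_le power_le_one) auto
    have "(8 / 3 * l + t\<^sup>2 / 4) * \<sigma>\<^sup>2 \<le> t\<^sup>2"
      using 1 2 by (simp add: algebra_simps)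
    then have "4 / 3 * l + t\<^sup>2 / 8 \<le> t\<^sup>2 / (2 * \<sigma>\<^sup>2)"
      using s by (simp add: field_simps)
    then show ?thesis by (simp flip: exp_add)
  qed
  finally have p: "measure std_normal_distribution {x. \<bar>m + s * x\<bar> \<le> \<Lambda>} \<le> exp (- (4 / 3) * l) * exp (- t\<^sup>2 / 8)" .
  \<comment> \<open>The exponent is chosen so that squaring yields \<open>exp (t^2 / 8)\<close>,
    which cancels the reserved factor.\<close>
  have "1 + t \<le> 8 * exp (t\<^sup>2 / 16)"
  proof -
    have "0 \<le> (t - 1)\<^sup>2" by simp
    then have "1 + t \<le> 8 * (1 + t\<^sup>2 / 16)"
      by (simp add: power2_eq_square algebra_simps)
    also have "\<dots> \<le> 8 * exp (t\<^sup>2 / 16)"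
      by (intro mult_left_mono exp_ge_add_one_self) simp
    finally show ?thesis .
  qed
  then have "(1 + t)\<^sup>2 \<le> (8 * exp (t\<^sup>2 / 16))\<^sup>2"
    using t by (intro power_mono) auto
  also have "\<dots> = 64 * exp (t\<^sup>2 / 8)"
    by (simp add: power_mult_distrib flip: exp_double)
  finally have t1: "(1 + t)\<^sup>2 \<le> 64 * exp (t\<^sup>2 / 8)" .
  have "(1 + \<Lambda>) * (1 + t) = 1 + \<bar>m\<bar> + \<Lambda> * t"
    by (simp add: t_def algebra_simps)
  then have "1 + \<bar>m\<bar> \<le> (1 + \<Lambda>) * (1 + t)"
    using t(2) \<open>0 \<le> \<Lambda>\<close> by simp
  then have "(1 + \<bar>m\<bar>)\<^sup>2 \<le> (1 + \<Lambda>)\<^sup>2 * (1 + t)\<^sup>2"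
    unfolding power_mult_distrib[symmetric] by (intro power_mono) auto
  also have "\<dots> \<le> (1 + \<Lambda>)\<^sup>2 * (64 * exp (t\<^sup>2 / 8))"
    using t1 by (intro mult_left_mono) auto
  finally have "measure std_normal_distribution {x. \<bar>m + s * x\<bar> \<le> \<Lambda>} * (1 + \<bar>m\<bar>)\<^sup>2
     \<le> (exp (- (4 / 3) * l) * exp (- t\<^sup>2 / 8)) * ((1 + \<Lambda>)\<^sup>2 * (64 * exp (t\<^sup>2 / 8)))"
    by (intro mult_mono p) auto
  also have "\<dots> = 64 * (1 + \<Lambda>)\<^sup>2 * exp (- (4 / 3) * l) * (exp (- t\<^sup>2 / 8) * exp (t\<^sup>2 / 8))"
    by simp
  also have "exp (- t\<^sup>2 / 8) * exp (t\<^sup>2 / 8) = 1"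
    by (simp flip: exp_add)
  finally show ?thesis by simp
qed

text \<open>The difference is the density plus \<open>m * Phi m\<close>: at most linear everywhere,
  and Gaussian small on the side where the lower branch is the right one.\<close>

lemma G_minus_lower:
  assumes "0 < \<beta>" "\<beta> < 1"
  shows "\<bar>G m \<beta> + \<beta> * m\<bar> \<le> 1 + \<bar>m\<bar>"
    and "m \<le> 0 \<Longrightarrow> \<bar>G m \<beta> + \<beta> * m\<bar> \<le> (1 + \<bar>m\<bar>) * exp (- m\<^sup>2 / 2)"
proof -
  have "\<bar>G m \<beta> + \<beta> * m\<bar> \<le> \<bar>std_normal_density m\<bar> + \<bar>m\<bar> * \<bar>Phi m\<bar>"
    using abs_triangle_ineq[of "std_normal_density m" "m * Phi m"] by (simp add: G_def abs_mult)
  also have "\<dots> = std_normal_density m + \<bar>m\<bar> * Phi m"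
    using Phi_nonneg[of m] by simp
  finally have le: "\<bar>G m \<beta> + \<beta> * m\<bar> \<le> std_normal_density m + \<bar>m\<bar> * Phi m" .
  also have "\<dots> \<le> exp (- m\<^sup>2 / 2) + \<bar>m\<bar> * 1"
    by (intro add_mono mult_left_mono std_normal_density_le_exp Phi_le_1) auto
  also have "exp (- m\<^sup>2 / 2) \<le> 1" by simp
  finally show "\<bar>G m \<beta> + \<beta> * m\<bar> \<le> 1 + \<bar>m\<bar>" by simp
  assume "m \<le> 0"
  note le
  also have "std_normal_density m + \<bar>m\<bar> * Phi m \<le> exp (- m\<^sup>2 / 2) + \<bar>m\<bar> * exp (- m\<^sup>2 / 2)"
    using \<open>m \<le> 0\<close> by (intro add_mono mult_left_mono std_normal_density_le_exp Phi_tail_le) auto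
  finally show "\<bar>G m \<beta> + \<beta> * m\<bar> \<le> (1 + \<bar>m\<bar>) * exp (- m\<^sup>2 / 2)"
    by (simp add: algebra_simps)
qed

text \<open>Mirror image of the lower branch: the difference is the density minus
  \<open>m * (1 - Phi m)\<close>.\<close>

lemma G_minus_upper:
  assumes "0 < \<beta>" "\<beta> < 1"
  shows "\<bar>G m \<beta> - (1 - \<beta>) * m\<bar> \<le> 1 + \<bar>m\<bar>"
    and "0 \<le> m \<Longrightarrow> \<bar>G m \<beta> - (1 - \<beta>) * m\<bar> \<le> (1 + \<bar>m\<bar>) * exp (- m\<^sup>2 / 2)"
proof -
  have "G m \<beta> - (1 - \<beta>) * m = std_normal_density m - m * (1 - Phi m)"
    by (simp add: G_def algebra_simps)
  also have "\<bar>\<dots>\<bar> \<le> \<bar>std_normal_density m\<bar> + \<bar>m\<bar> * \<bar>1 - Phi m\<bar>"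
    using abs_triangle_ineq4[of "std_normal_density m" "m * (1 - Phi m)"] by (simp add: abs_mult)
  also have "\<dots> = std_normal_density m + \<bar>m\<bar> * (1 - Phi m)"
    using Phi_le_1[of m] by simp
  finally have le: "\<bar>G m \<beta> - (1 - \<beta>) * m\<bar> \<le> std_normal_density m + \<bar>m\<bar> * (1 - Phi m)" .
  also have "\<dots> \<le> exp (- m\<^sup>2 / 2) + \<bar>m\<bar> * 1"
    using Phi_nonneg[of m] by (intro add_mono mult_left_mono std_normal_density_le_exp) auto
  also have "exp (- m\<^sup>2 / 2) \<le> 1" by simp
  finally show "\<bar>G m \<beta> - (1 - \<beta>) * m\<bar> \<le> 1 + \<bar>m\<bar>" by simp
  assume "0 \<le> m"
  note le
  also have "std_normal_density m + \<bar>m\<bar> * (1 - Phi m) \<le> exp (- m\<^sup>2 / 2) + \<bar>m\<bar> * exp (- m\<^sup>2 / 2)"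
    using \<open>0 \<le> m\<close> by (intro add_mono mult_left_mono std_normal_density_le_exp Phi_upper_tail_le) auto
  finally show "\<bar>G m \<beta> - (1 - \<beta>) * m\<bar> \<le> (1 + \<bar>m\<bar>) * exp (- m\<^sup>2 / 2)"
    by (simp add: algebra_simps)
qed

section \<open>Independence of the two Gaussian copies\<close>

lemma nn_integral_std_normal_pair:
  assumes [measurable]: "f \<in> borel_measurable (borel \<Otimes>\<^sub>M borel)"
  shows "(\<integral>\<^sup>+p. f p \<partial>(std_normal_distribution \<Otimes>\<^sub>M std_normal_distribution)) =
    (\<integral>\<^sup>+y. \<integral>\<^sup>+z. ennreal (std_normal_density y * std_normal_density z) * f (y, z) \<partial>lborel \<partial>lborel)"
proof -
  have "(\<integral>\<^sup>+p. f p \<partial>(std_normal_distribution \<Otimes>\<^sub>M std_normal_distribution)) =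
     (\<integral>\<^sup>+y. \<integral>\<^sup>+z. f (y, z) \<partial>std_normal_distribution \<partial>std_normal_distribution)"
    by (rule std_normal.nn_integral_fst[symmetric]) measurable
  also have "\<dots> = (\<integral>\<^sup>+y. \<integral>\<^sup>+z. ennreal (std_normal_density y * std_normal_density z) * f (y, z) \<partial>lborel \<partial>lborel)"
    by (subst nn_integral_density nn_integral_density, measurable)+
       (simp add: nn_integral_cmult[symmetric] ennreal_mult mult_ac)
  finally show ?thesis .
qed

text \<open>The map is orthogonal, a reflection, so it preserves area and the product density.
  Variables are changed one at a time, and the Jacobian factors \<open>sqrt 2\<close> and
  \<open>1 / sqrt 2\<close> cancel.\<close>

lemma distr_std_normal_pair_rotate:
  "distr (std_normal_distribution \<Otimes>\<^sub>M std_normal_distribution) (borel \<Otimes>\<^sub>M borel)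
     (\<lambda>(y, z). (- (y + z) / sqrt 2, (z - y) / sqrt 2))
   = std_normal_distribution \<Otimes>\<^sub>M std_normal_distribution" (is "distr ?NN _ ?R = _")
proof (rule measure_eqI)
  show "sets (distr ?NN (borel \<Otimes>\<^sub>M borel) ?R) = sets ?NN"
    by (simp cong: sets_pair_measure_cong)
next
  fix A assume "A \<in> sets (distr ?NN (borel \<Otimes>\<^sub>M borel) ?R)"
  then have A[measurable]: "A \<in> sets (borel \<Otimes>\<^sub>M (borel :: real measure))" by simp
  have sets_NN[measurable_cong]: "sets ?NN = sets (borel \<Otimes>\<^sub>M borel)"
    by (simp cong: sets_pair_measure_cong)
  let ?f = "indicator A :: real \<times> real \<Rightarrow> ennreal"
  let ?p = "\<lambda>a b. ennreal (std_normal_density a * std_normal_density b)"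
  have R[measurable]: "?R \<in> ?NN \<rightarrow>\<^sub>M borel \<Otimes>\<^sub>M borel"
    by measurable
  have "emeasure (distr ?NN (borel \<Otimes>\<^sub>M borel) ?R) A = (\<integral>\<^sup>+p. ?f (?R p) \<partial>?NN)"
    using nn_integral_distr[OF R, of ?f] by (simp add: nn_integral_indicator)
  also have "\<dots> = (\<integral>\<^sup>+y. \<integral>\<^sup>+z. ?p y z * ?f (- (y + z) / sqrt 2, (z - y) / sqrt 2) \<partial>lborel \<partial>lborel)"
    by (subst nn_integral_std_normal_pair) auto
  also have "\<dots> = (\<integral>\<^sup>+y. ennreal (sqrt 2) * (\<integral>\<^sup>+a. ?p y (- y - sqrt 2 * a) * ?f (a, - sqrt 2 * y - a) \<partial>lborel) \<partial>lborel)"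
  proof (intro nn_integral_cong)
    fix y :: real
    have R: "- (y + (- y + - sqrt 2 * a)) / sqrt 2 = a" "(- y - sqrt 2 * a - y) / sqrt 2 = - sqrt 2 * y - a"
      "- y + - sqrt 2 * a = - y - sqrt 2 * a" for a
      by (simp_all add: field_simps)
    show "(\<integral>\<^sup>+z. ?p y z * ?f (- (y + z) / sqrt 2, (z - y) / sqrt 2) \<partial>lborel)
      = ennreal (sqrt 2) * (\<integral>\<^sup>+a. ?p y (- y - sqrt 2 * a) * ?f (a, - sqrt 2 * y - a) \<partial>lborel)"
      by (subst nn_integral_real_affine[where t="- y" and c="- sqrt 2"]) (simp_all only: R, simp_all)
  qed
  also have "\<dots> = ennreal (sqrt 2) * (\<integral>\<^sup>+y. \<integral>\<^sup>+a. ?p y (- y - sqrt 2 * a) * ?f (a, - sqrt 2 * y - a) \<partial>lborel \<partial>lborel)"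
    by (intro nn_integral_cmult) measurable
  \<comment> \<open>Exchanging the integrals frees \<open>y\<close> for the second substitution, now
    at fixed \<open>a\<close>.\<close>
  also have "(\<integral>\<^sup>+y. \<integral>\<^sup>+a. ?p y (- y - sqrt 2 * a) * ?f (a, - sqrt 2 * y - a) \<partial>lborel \<partial>lborel) =
     (\<integral>\<^sup>+a. \<integral>\<^sup>+y. ?p y (- y - sqrt 2 * a) * ?f (a, - sqrt 2 * y - a) \<partial>lborel \<partial>lborel)"
    by (rule lborel_pair.Fubini') measurable
  also have "ennreal (sqrt 2) * \<dots> = ennreal (sqrt 2) * (\<integral>\<^sup>+a. ennreal (1 / sqrt 2) * (\<integral>\<^sup>+b. ?p a b * ?f (a, b) \<partial>lborel) \<partial>lborel)"
  proof (intro arg_cong[where f="\<lambda>x. ennreal (sqrt 2) * x"] nn_integral_cong)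
    fix a :: real
    have dens: "?p (- (a / sqrt 2) + (- 1 / sqrt 2) * b) (- (- (a / sqrt 2) + (- 1 / sqrt 2) * b) - sqrt 2 * a) = ?p a b" for b
    proof -
      have "(- (a / sqrt 2) + (- 1 / sqrt 2) * b)\<^sup>2 + (- (- (a / sqrt 2) + (- 1 / sqrt 2) * b) - sqrt 2 * a)\<^sup>2 = a\<^sup>2 + b\<^sup>2"
        by (simp add: power2_eq_square field_simps)
      then show ?thesis
        by (simp add: std_normal_density_def exp_add[symmetric] add_divide_distrib[symmetric] del: exp_add)
    qed
    have snd: "- sqrt 2 * (- (a / sqrt 2) + (- 1 / sqrt 2) * b) - a = b" for b
      by (simp add: field_simps)
    show "(\<integral>\<^sup>+y. ?p y (- y - sqrt 2 * a) * ?f (a, - sqrt 2 * y - a) \<partial>lborel)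
      = ennreal (1 / sqrt 2) * (\<integral>\<^sup>+b. ?p a b * ?f (a, b) \<partial>lborel)"
      by (subst nn_integral_real_affine[where t="- (a / sqrt 2)" and c="- 1 / sqrt 2"])
         (simp_all only: dens snd, simp_all)
  qed
  also have "\<dots> = ennreal (sqrt 2) * (ennreal (1 / sqrt 2) * (\<integral>\<^sup>+a. \<integral>\<^sup>+b. ?p a b * ?f (a, b) \<partial>lborel \<partial>lborel))"
    by (intro arg_cong[where f="\<lambda>x. ennreal (sqrt 2) * x"] nn_integral_cmult) measurable
  also have "\<dots> = (\<integral>\<^sup>+a. \<integral>\<^sup>+b. ?p a b * ?f (a, b) \<partial>lborel \<partial>lborel)"
    by (simp add: mult.assoc[symmetric] ennreal_mult[symmetric])
  also have "\<dots> = (\<integral>\<^sup>+p. ?f p \<partial>?NN)"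
    by (rule nn_integral_std_normal_pair[symmetric]) measurable
  also have "\<dots> = emeasure ?NN A"
    by (simp add: sets_NN)
  finally show "emeasure (distr ?NN (borel \<Otimes>\<^sub>M borel) ?R) A = emeasure ?NN A" .
qed

text \<open>With \<open>Y\<close> the standardised \<open>X\<close>, the two combinations are the
  noise in \<open>U\<close> and in \<open>V\<close>. Their signs compensate for
  \<open>d_coef\<close> being nonpositive, so both carry the scale \<open>s \<ge> 0\<close>.\<close>

lemma (in prob_space) indep_std_normal_rotate:
  assumes Y: "distributed M lborel Y std_normal_density"
    and Z: "distributed M lborel Z std_normal_density"
    and indep: "indep_var borel Y borel Z"
  defines "A \<equiv> \<lambda>\<omega>. - (Y \<omega> + Z \<omega>) / sqrt 2" and "B \<equiv> \<lambda>\<omega>. (Z \<omega> - Y \<omega>) / sqrt 2"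
  shows "distr M borel A = std_normal_distribution" "distr M borel B = std_normal_distribution"
    and "indep_var borel A borel B"
proof -
  interpret NN: pair_prob_space std_normal_distribution std_normal_distribution ..
  have [measurable]: "random_variable borel Y" "random_variable borel Z"
    using distributed_measurable[OF Y] distributed_measurable[OF Z] by simp_all
  have [measurable]: "random_variable borel A" "random_variable borel B"
    unfolding A_def B_def by measurable
  have dist: "distr M borel W = std_normal_distribution" if "distributed M lborel W std_normal_density" for W
    using distributed_distr_eq_density[OF that] by (simp cong: distr_cong)
  have "distr M (borel \<Otimes>\<^sub>M borel) (\<lambda>\<omega>. (A \<omega>, B \<omega>)) =
     distr (distr M (borel \<Otimes>\<^sub>M borel) (\<lambda>\<omega>. (Y \<omega>, Z \<omega>))) (borel \<Otimes>\<^sub>M borel)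
       (\<lambda>(y, z). (- (y + z) / sqrt 2, (z - y) / sqrt 2))"
    by (subst distr_distr) (auto simp: A_def B_def comp_def)
  also have "distr M (borel \<Otimes>\<^sub>M borel) (\<lambda>\<omega>. (Y \<omega>, Z \<omega>)) = std_normal_distribution \<Otimes>\<^sub>M std_normal_distribution"
    using indep unfolding indep_var_distribution_eq dist[OF Y] dist[OF Z] by simp
  finally have AB: "distr M (borel \<Otimes>\<^sub>M borel) (\<lambda>\<omega>. (A \<omega>, B \<omega>)) = std_normal_distribution \<Otimes>\<^sub>M std_normal_distribution"
    unfolding distr_std_normal_pair_rotate .
  have "distr M borel A = distr (distr M (borel \<Otimes>\<^sub>M borel) (\<lambda>\<omega>. (A \<omega>, B \<omega>))) borel fst"
    by (subst distr_distr) (auto simp: comp_def)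
  also have "\<dots> = std_normal_distribution"
    unfolding AB using std_normal.distr_pair_fst[of std_normal_distribution] by (simp cong: distr_cong)
  finally show A: "distr M borel A = std_normal_distribution" .
  have "distr M borel B = distr (distr M (borel \<Otimes>\<^sub>M borel) (\<lambda>\<omega>. (A \<omega>, B \<omega>))) borel snd"
    by (subst distr_distr) (auto simp: comp_def)
  also have "\<dots> = std_normal_distribution"
    unfolding AB by (subst NN.distr_pair_swap, subst distr_distr)
      (use std_normal.distr_pair_fst[of std_normal_distribution] in \<open>auto simp: comp_def case_prod_beta cong: distr_cong\<close>)
  finally show B: "distr M borel B = std_normal_distribution" .
  show "indep_var borel A borel B"
    unfolding indep_var_distribution_eq A B AB by simp
qed

section \<open>Moments of a three-branch rule\<close>

definition thresholded :: "real \<Rightarrow> (real \<Rightarrow> real) \<Rightarrow> (real \<Rightarrow> real) \<Rightarrow> (real \<Rightarrow> real) \<Rightarrow> real \<Rightarrow> real \<Rightarrow> real" where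
  "thresholded \<Lambda> F1 F2 F3 u v =
     (if v < - \<Lambda> then F1 u else if \<bar>v\<bar> \<le> \<Lambda> then F2 u else F3 u)"

text \<open>\<open>B\<close> selects the branch and \<open>A\<close> supplies its argument, so
  independence splits each term into a probability times an integral. General branches let the
  formula serve both the estimator and its squared deviation.\<close>

lemma (in prob_space) thresholded_expectation:
  assumes A: "distr M borel A = std_normal_distribution" and B: "distr M borel B = std_normal_distribution"
    and indep: "indep_var borel A borel B"
    and F: "integrable std_normal_distribution (\<lambda>x. F1 (m + s * x))"
      "integrable std_normal_distribution (\<lambda>x. F2 (m + s * x))"
      "integrable std_normal_distribution (\<lambda>x. F3 (m + s * x))"
    and "0 \<le> \<Lambda>"
  defines "p1 \<equiv> measure std_normal_distribution {x. m + s * x < - \<Lambda>}"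
    and "p2 \<equiv> measure std_normal_distribution {x. \<bar>m + s * x\<bar> \<le> \<Lambda>}"
    and "p3 \<equiv> measure std_normal_distribution {x. \<Lambda> < m + s * x}"
  shows "integrable M (\<lambda>\<omega>. thresholded \<Lambda> F1 F2 F3 (m + s * A \<omega>) (m + s * B \<omega>))"
    and "expectation (\<lambda>\<omega>. thresholded \<Lambda> F1 F2 F3 (m + s * A \<omega>) (m + s * B \<omega>)) =
      p1 * (LINT x|std_normal_distribution. F1 (m + s * x)) +
      p2 * (LINT x|std_normal_distribution. F2 (m + s * x)) +
      p3 * (LINT x|std_normal_distribution. F3 (m + s * x))"
    and "p1 + p2 + p3 = 1"
proof -
  have [measurable]: "random_variable borel A" "random_variable borel B"
    using indep_var_rv1[OF indep] indep_var_rv2[OF indep] by auto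
  have prod: "integrable M (\<lambda>\<omega>. f (A \<omega>) * indicator S (B \<omega>))"
    "expectation (\<lambda>\<omega>. f (A \<omega>) * indicator S (B \<omega>)) =
      measure std_normal_distribution S * (LINT x|std_normal_distribution. f x)"
    if f: "integrable std_normal_distribution f" and S[measurable]: "S \<in> sets borel" for f :: "real \<Rightarrow> real" and S
  proof -
    have [measurable]: "f \<in> borel_measurable borel"
      using borel_measurable_integrable[OF f] by simp
    have fA: "integrable M (\<lambda>\<omega>. f (A \<omega>))"
      using f integrable_distr_eq[of A M borel f] unfolding A by simp
    have SB: "integrable M (\<lambda>\<omega>. indicator S (B \<omega>) :: real)"
      by (intro integrable_const_bound[of _ 1]) (auto simp: indicator_def)
    have ind: "indep_var borel (\<lambda>\<omega>. f (A \<omega>)) borel (\<lambda>\<omega>. indicator S (B \<omega>) :: real)"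
      using indep_var_compose[OF indep, of f borel "indicator S" borel] by (simp add: comp_def)
    show "integrable M (\<lambda>\<omega>. f (A \<omega>) * indicator S (B \<omega>))"
      by (rule indep_var_integrable[OF ind fA SB])
    have "expectation (\<lambda>\<omega>. f (A \<omega>)) = (LINT x|std_normal_distribution. f x)"
      unfolding A[symmetric] by (subst integral_distr) auto
    moreover have "expectation (\<lambda>\<omega>. indicator S (B \<omega>)) = measure std_normal_distribution S"
    proof -
      have "expectation (\<lambda>\<omega>. indicator S (B \<omega>) :: real) = (LINT x|std_normal_distribution. indicator S x)"
        unfolding B[symmetric] by (subst integral_distr) auto
      then show ?thesis by simp
    qed
    ultimately show "expectation (\<lambda>\<omega>. f (A \<omega>) * indicator S (B \<omega>)) =
      measure std_normal_distribution S * (LINT x|std_normal_distribution. f x)"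
      using indep_var_lebesgue_integral[OF ind fA SB] by (simp add: mult.commute)
  qed
  let ?S1 = "{x. m + s * x < - \<Lambda>}" and ?S2 = "{x. \<bar>m + s * x\<bar> \<le> \<Lambda>}" and ?S3 = "{x. \<Lambda> < m + s * x}"
  have S: "?S1 \<in> sets borel" "?S2 \<in> sets borel" "?S3 \<in> sets borel"
    by measurable
  \<comment> \<open>A nonnegative threshold makes the three indicator sets disjoint.\<close>
  have T: "(\<lambda>\<omega>. thresholded \<Lambda> F1 F2 F3 (m + s * A \<omega>) (m + s * B \<omega>)) =
     (\<lambda>\<omega>. F1 (m + s * A \<omega>) * indicator ?S1 (B \<omega>) + F2 (m + s * A \<omega>) * indicator ?S2 (B \<omega>) +
        F3 (m + s * A \<omega>) * indicator ?S3 (B \<omega>))"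
    using \<open>0 \<le> \<Lambda>\<close> by (auto simp: thresholded_def fun_eq_iff indicator_def)
  show "integrable M (\<lambda>\<omega>. thresholded \<Lambda> F1 F2 F3 (m + s * A \<omega>) (m + s * B \<omega>))"
    unfolding T by (intro Bochner_Integration.integrable_add prod(1)[OF F(1) S(1)] prod(1)[OF F(2) S(2)] prod(1)[OF F(3) S(3)])
  show "expectation (\<lambda>\<omega>. thresholded \<Lambda> F1 F2 F3 (m + s * A \<omega>) (m + s * B \<omega>)) =
      p1 * (LINT x|std_normal_distribution. F1 (m + s * x)) +
      p2 * (LINT x|std_normal_distribution. F2 (m + s * x)) +
      p3 * (LINT x|std_normal_distribution. F3 (m + s * x))"
    unfolding T p1_def p2_def p3_def
    by (simp add: prod(2)[OF F(1) S(1)] prod(2)[OF F(2) S(2)] prod(2)[OF F(3) S(3)]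
        prod(1)[OF F(1) S(1)] prod(1)[OF F(2) S(2)] prod(1)[OF F(3) S(3)])
  have "p1 + p2 + p3 = measure std_normal_distribution (?S1 \<union> ?S2 \<union> ?S3)"
    unfolding p1_def p2_def p3_def using S \<open>0 \<le> \<Lambda>\<close>
    by (subst std_normal.finite_measure_Union, auto)+
  also have "?S1 \<union> ?S2 \<union> ?S3 = UNIV"
    by auto
  finally show "p1 + p2 + p3 = 1"
    using std_normal.prob_space by simp
qed

text \<open>The degree 1 case of the rescaled Hermite formulas, \<open>hermite 1\<close> being the
  identity polynomial.\<close>

lemma integral_affine_std_normal:
  "integrable std_normal_distribution (\<lambda>x. a + b * x)"
  "integrable std_normal_distribution (\<lambda>x. (a + b * x)\<^sup>2)"
  "(LINT x|std_normal_distribution. a + b * x) = a"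
  "(LINT x|std_normal_distribution. (a + b * x)\<^sup>2) = a\<^sup>2 + b\<^sup>2"
proof -
  have sh: "scaled_hermite 1 b (a + b * x) = a + b * x" for x
    by (simp add: scaled_hermite_def)
  show "integrable std_normal_distribution (\<lambda>x. a + b * x)"
    using integrable_scaled_hermite(1)[of 1 b a] unfolding sh .
  show "integrable std_normal_distribution (\<lambda>x. (a + b * x)\<^sup>2)"
    using integrable_scaled_hermite(2)[of 1 b a] unfolding sh .
  show "(LINT x|std_normal_distribution. a + b * x) = a"
    using integral_scaled_hermite[of 1 b a] unfolding sh by simp
  show "(LINT x|std_normal_distribution. (a + b * x)\<^sup>2) = a\<^sup>2 + b\<^sup>2"
    using integral_scaled_hermite_sq[of 1 b a] unfolding sh by simp
qed

text \<open>The mean minimises the mean square deviation, so a convenient centre can replace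
  it.\<close>

lemma (in prob_space) variance_le_second_moment:
  fixes X :: "'a \<Rightarrow> real"
  assumes "integrable M X" "integrable M (\<lambda>\<omega>. (X \<omega>)\<^sup>2)"
  shows "variance X \<le> expectation (\<lambda>\<omega>. (X \<omega> - c)\<^sup>2)"
proof -
  have "expectation (\<lambda>\<omega>. (X \<omega> - c)\<^sup>2) = expectation (\<lambda>\<omega>. (X \<omega>)\<^sup>2) - 2 * c * expectation X + c\<^sup>2"
    using assms by (simp add: power2_diff prob_space mult_ac)
  moreover have "variance X = expectation (\<lambda>\<omega>. (X \<omega>)\<^sup>2) - (expectation X)\<^sup>2"
    using assms by (rule variance_eq)
  moreover have "0 \<le> (expectation X)\<^sup>2 - 2 * c * expectation X + c\<^sup>2"
    using zero_le_power2[of "expectation X - c"] by (simp add: power2_diff mult_ac)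
  ultimately show ?thesis by linarith
qed

section \<open>Bias and variance bounds for one coordinate\<close>

text \<open>
  Here \<open>l\<close> stands for \<open>log n\<close>, so clipping at \<open>exp l\<close> is clipping at \<open>n\<close>, and \<open>\<sigma>\<close> for
  \<open>sqrt (2 \<nu>\<^sub>p / \<nu>\<^sub>f)\<close>. The condition \<open>\<gamma> < 1 / sqrt (4 e) - sqrt (\<nu>\<^sub>p / \<nu>\<^sub>f)\<close> enters only through
  \<open>(\<gamma> + \<sigma>)\<^sup>2 \<le> 1 / (2 e)\<close>.
\<close>
locale truncated_Hermite_estimator =
  fixes \<beta> g \<sigma> l :: real and K :: nat
  assumes \<beta>: "0 < \<beta>" "\<beta> < 1"
    and g: "0 < g" and \<sigma>: "0 < \<sigma>" and g_\<sigma>: "(g + \<sigma>)\<^sup>2 \<le> 1 / (2 * exp 1)"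
    and l: "0 \<le> l"
    and K: "(exp 1)\<^sup>2 * (g + \<sigma>)\<^sup>2 * (2 * l) \<le> real K" "0 < K"
begin

definition "\<Lambda> = g * sqrt (2 * l)"

definition S :: "real \<Rightarrow> real \<Rightarrow> real" where
  "S s u = clip (exp l) (S_sum \<beta> K s u)"

text \<open>This value is sharp enough for the numerical comparisons with e below.\<close>

lemma e_ge: "5 / 2 \<le> exp (1::real)"
  using exp_lower_Taylor_quadratic[of "1::real"] by simp

lemma \<Lambda>_nonneg: "0 \<le> \<Lambda>"
  using g l by (simp add: \<Lambda>_def)

lemma \<sigma>_sq: "\<sigma>\<^sup>2 \<le> 1 / (2 * exp 1)"
proof -
  have "\<sigma>\<^sup>2 \<le> (g + \<sigma>)\<^sup>2" using g \<sigma> by (intro power_mono) auto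
  then show ?thesis using g_\<sigma> by simp
qed

lemma \<sigma>_le_1: "\<sigma> \<le> 1"
proof (rule power2_le_imp_le)
  have "1 / (2 * exp 1) \<le> (1 :: real)" using e_ge by (simp add: field_simps)
  then show "\<sigma>\<^sup>2 \<le> 1\<^sup>2" using \<sigma>_sq unfolding power_one by linarith
qed simp

context
  fixes s m :: real
  assumes s: "0 \<le> s" "s \<le> \<sigma>"
begin

lemma s_sq_le: "s\<^sup>2 \<le> 1 / (2 * exp 1)" "s\<^sup>2 < 1"
proof -
  have "s\<^sup>2 \<le> \<sigma>\<^sup>2" using s by (intro power_mono) auto
  then show *: "s\<^sup>2 \<le> 1 / (2 * exp 1)" using \<sigma>_sq by simp
  have "1 / (2 * exp 1) < (1 :: real)" using e_ge by (simp add: field_simps)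
  with * show "s\<^sup>2 < 1" by linarith
qed

lemma S_integrable:
  "integrable std_normal_distribution (\<lambda>x. S s (m + s * x))"
  "integrable std_normal_distribution (\<lambda>x. (S s (m + s * x) - c)\<^sup>2)"
proof -
  have b: "\<bar>S s u\<bar> \<le> exp l" for u
    by (simp add: S_def abs_clip_le)
  have [measurable]: "S s \<in> borel_measurable borel"
    unfolding S_def[abs_def] by measurable
  show "integrable std_normal_distribution (\<lambda>x. S s (m + s * x))"
    by (rule std_normal.integrable_const_bound[of _ "exp l"]) (use b in auto)
  show "integrable std_normal_distribution (\<lambda>x. (S s (m + s * x) - c)\<^sup>2)"
  proof (rule std_normal.integrable_const_bound[of _ "(exp l + \<bar>c\<bar>)\<^sup>2"])
    have "\<bar>S s u - c\<bar> \<le> exp l + \<bar>c\<bar>" for u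
      using b[of u] by linarith
    then have "\<bar>S s u - c\<bar>\<^sup>2 \<le> (exp l + \<bar>c\<bar>)\<^sup>2" for u
      by (rule power_mono) simp
    then show "AE x in std_normal_distribution. norm ((S s (m + s * x) - c)\<^sup>2) \<le> (exp l + \<bar>c\<bar>)\<^sup>2"
      by simp
  qed measurable
qed

text \<open>
  Three inequalities meet in the factor \<open>\<kappa> = 4 / 3\<close>: beyond this range the middle event has probability
  \<open>n\<close> to a power below \<open>-1\<close> since \<open>3 / 4 \<cdot> \<kappa>\<^sup>2 > 1\<close>; within it the second moment of the series has exponent
  \<open>\<kappa>\<^sup>2 / (e - 1 / 2) \<le> 9 / 10\<close>, and the Taylor remainder has ratio \<open>\<kappa> / sqrt e \<le> 6 / 7\<close>.
\<close>
abbreviation "near \<equiv> \<bar>m\<bar> \<le> 4 / 3 * (g + \<sigma>) * sqrt (2 * l)"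

lemma near_sq:
  assumes near
  shows "m\<^sup>2 \<le> 32 / 9 * (g + \<sigma>)\<^sup>2 * l"
proof -
  have "\<bar>m\<bar>\<^sup>2 \<le> (4 / 3 * (g + \<sigma>) * sqrt (2 * l))\<^sup>2"
    using assms by (rule power_mono) simp
  also have "\<dots> = (4 / 3)\<^sup>2 * (g + \<sigma>)\<^sup>2 * (2 * l)"
    using l by (simp only: power_mult_distrib) simp
  finally show ?thesis
    by (simp add: power_divide mult_ac)
qed

lemma near_second_moment:
  assumes near
  shows "(LINT x|std_normal_distribution. (S_sum \<beta> K s (m + s * x))\<^sup>2) \<le> (real K + 1)\<^sup>2 * exp (9 / 10 * l)"
proof -
  have "m\<^sup>2 \<le> 32 / 9 * (1 / (2 * exp 1)) * l"
    using near_sq[OF assms] g_\<sigma> l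
    by (elim order_trans) (intro mult_right_mono mult_left_mono, auto)
  also have "\<dots> \<le> 9 / 10 * l * (1 - 1 / (2 * exp 1))"
  proof -
    \<comment> \<open>Cleared of denominators this is
      \<open>32 / 9 \<le> 9 / 10 * (2 * e - 1)\<close>; at \<open>e = 5 / 2\<close> the right side
      is already 18/5.\<close>
    have "32 / 9 * (1 / (2 * exp 1)) \<le> 9 / 10 * (1 - 1 / (2 * exp (1::real)))"
      using e_ge by (simp add: field_simps)
    from mult_right_mono[OF this l] show ?thesis by (simp add: mult_ac)
  qed
  also have "\<dots> \<le> 9 / 10 * l * (1 - s\<^sup>2)"
    using s_sq_le l by (intro mult_left_mono) auto
  finally have "m\<^sup>2 / (1 - s\<^sup>2) \<le> 9 / 10 * l"
    using s_sq_le by (simp add: field_simps)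
  then have "(real K + 1)\<^sup>2 * exp (m\<^sup>2 / (1 - s\<^sup>2)) \<le> (real K + 1)\<^sup>2 * exp (9 / 10 * l)"
    by (intro mult_left_mono) auto
  with integral_S_sum_sq_le[OF \<beta> s_sq_le(2), of K m] show ?thesis by (rule order_trans)
qed

text \<open>Clipping at n costs the second moment divided by n, hence the exponent 9/10 - 1. The
  unclipped series is unbiased for the Taylor polynomial, which leaves the remainder.\<close>

lemma near_bias:
  assumes near
  shows "\<bar>(LINT x|std_normal_distribution. S s (m + s * x)) - G m \<beta>\<bar>
    \<le> 7 * (6 / 7) ^ K + (real K + 1)\<^sup>2 * exp (- l / 10)"
proof -
  let ?I = "LINT x|std_normal_distribution. S s (m + s * x)"
  let ?J = "LINT x|std_normal_distribution. S_sum \<beta> K s (m + s * x)"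
  have "\<bar>?I - ?J\<bar> = \<bar>LINT x|std_normal_distribution. S s (m + s * x) - S_sum \<beta> K s (m + s * x)\<bar>"
    by (subst Bochner_Integration.integral_diff) (auto intro: S_integrable integrable_S_sum)
  also have "\<dots> \<le> (LINT x|std_normal_distribution. \<bar>S s (m + s * x) - S_sum \<beta> K s (m + s * x)\<bar>)"
    by (rule integral_abs_bound)
  also have "\<dots> \<le> (LINT x|std_normal_distribution. (S_sum \<beta> K s (m + s * x))\<^sup>2 / exp l)"
    by (intro integral_mono integrable_abs Bochner_Integration.integrable_diff S_integrable integrable_S_sum
        integrable_divide) (simp add: S_def abs_diff_clip_le)
  also have "\<dots> = (LINT x|std_normal_distribution. (S_sum \<beta> K s (m + s * x))\<^sup>2) / exp l"
    by simp
  also have "\<dots> \<le> (real K + 1)\<^sup>2 * exp (9 / 10 * l) / exp l"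
    by (intro divide_right_mono near_second_moment assms) simp
  also have "\<dots> = (real K + 1)\<^sup>2 * exp (- l / 10)"
    by (simp add: exp_diff[symmetric] times_divide_eq_right[symmetric] del: times_divide_eq_right)
  finally have 1: "\<bar>?I - ?J\<bar> \<le> (real K + 1)\<^sup>2 * exp (- l / 10)" .
  have "exp 1 * m\<^sup>2 \<le> exp 1 * (32 / 9 * (g + \<sigma>)\<^sup>2 * l)"
    by (intro mult_left_mono near_sq assms) simp
  also have "\<dots> \<le> (6 / 7)\<^sup>2 * ((exp 1)\<^sup>2 * (g + \<sigma>)\<^sup>2 * (2 * l))"
  proof -
    \<comment> \<open>The choice of \<open>K\<close> provides an extra factor e; what is left is a
      lower bound on e of about 2.42.\<close>
    have "exp 1 * (32 / 9) \<le> (6 / 7)\<^sup>2 * ((exp 1)\<^sup>2 * (2::real))"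
      using e_ge by (simp add: power2_eq_square field_simps)
    then have "exp 1 * (32 / 9) * ((g + \<sigma>)\<^sup>2 * l) \<le> (6 / 7)\<^sup>2 * ((exp 1)\<^sup>2 * 2) * ((g + \<sigma>)\<^sup>2 * l)"
      using l by (intro mult_right_mono) auto
    then show ?thesis by (simp only: mult_ac)
  qed
  also have "\<dots> \<le> (6 / 7)\<^sup>2 * real K"
    by (intro mult_left_mono K) simp
  finally have "\<bar>?J - G m \<beta>\<bar> \<le> 7 * (6 / 7) ^ K"
    unfolding integral_S_sum by (intro G_Taylor_remainder \<beta> K)
  with 1 show ?thesis by linarith
qed

lemma far_prob:
  assumes "\<not> near"
  shows "measure std_normal_distribution {x. \<bar>m + s * x\<bar> \<le> \<Lambda>} * (1 + \<bar>m\<bar>)\<^sup>2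
    \<le> 64 * (1 + \<Lambda>)\<^sup>2 * exp (- (4 / 3) * l)"
proof (rule middle_prob_far_le[OF s \<sigma> \<sigma>_le_1 \<Lambda>_nonneg l])
  \<comment> \<open>The \<open>g\<close> part of the near radius covers \<open>\<Lambda>\<close>, as
    4/3 exceeds 1, and the \<open>\<sigma>\<close> part remains as distance.\<close>
  have "\<Lambda> + 4 / 3 * \<sigma> * sqrt (2 * l) \<le> 4 / 3 * (g + \<sigma>) * sqrt (2 * l)"
    using g l by (simp add: \<Lambda>_def algebra_simps)
  with assms show "\<Lambda> + 4 / 3 * \<sigma> * sqrt (2 * l) \<le> \<bar>m\<bar>" by linarith
qed

lemma abs_S_integral_le: "\<bar>LINT x|std_normal_distribution. S s (m + s * x)\<bar> \<le> exp l"
proof -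
  have "\<bar>LINT x|std_normal_distribution. S s (m + s * x)\<bar> \<le> (LINT x|std_normal_distribution. \<bar>S s (m + s * x)\<bar>)"
    by (rule integral_abs_bound)
  also have "\<dots> \<le> exp l"
    by (intro std_normal.integral_le_const integrable_abs S_integrable) (simp add: S_def abs_clip_le)
  finally show ?thesis .
qed

text \<open>In the near range the probability is bounded by 1. Beyond it the error is at most of
  order \<open>exp l * (1 + \<bar>m\<bar>)^2\<close>, and \<open>far_prob\<close> leaves the
  exponent 1 - 4/3. Adding the two bounds removes the case distinction.\<close>

lemma middle_bias:
  "measure std_normal_distribution {x. \<bar>m + s * x\<bar> \<le> \<Lambda>} *
     \<bar>(LINT x|std_normal_distribution. S s (m + s * x)) - G m \<beta>\<bar>
   \<le> 7 * (6 / 7) ^ K + (real K + 1)\<^sup>2 * exp (- l / 10) + 192 * (1 + \<Lambda>)\<^sup>2 * exp (- l / 3)"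
  (is "?p * \<bar>?I - _\<bar> \<le> ?a + ?b")
proof (cases near)
  case True
  have "?p * \<bar>?I - G m \<beta>\<bar> \<le> 1 * ?a"
    by (intro mult_mono near_bias True std_normal.prob_le_1) auto
  then show ?thesis by (simp add: add_increasing2)
next
  case False
  have "\<bar>?I - G m \<beta>\<bar> \<le> exp l + (1 + 2 * \<bar>m\<bar>)"
  proof -
    have "\<bar>\<beta> * m\<bar> \<le> \<bar>m\<bar>" using \<beta> by (simp add: abs_mult mult_left_le_one_le)
    then show ?thesis
      using abs_S_integral_le G_minus_lower(1)[OF \<beta>, of m] by linarith
  qed
  also have "\<dots> \<le> 3 * exp l * (1 + \<bar>m\<bar>)\<^sup>2"
  proof -
    have "1 \<le> exp l" using l by simp
    moreover have "1 + \<bar>m\<bar> \<le> exp l * (1 + \<bar>m\<bar>)"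
      using \<open>1 \<le> exp l\<close> by (simp add: mult_le_cancel_right1)
    moreover have "exp l * 1 \<le> exp l * (1 + \<bar>m\<bar>)"
      by (intro mult_left_mono) auto
    ultimately have "exp l + (1 + 2 * \<bar>m\<bar>) \<le> 3 * exp l * (1 + \<bar>m\<bar>)"
      by linarith
    also have "\<dots> \<le> 3 * exp l * (1 + \<bar>m\<bar>)\<^sup>2"
      using mult_left_mono[of 1 "1 + \<bar>m\<bar>" "1 + \<bar>m\<bar>"]
      by (intro mult_left_mono) (auto simp: power2_eq_square)
    finally show ?thesis .
  qed
  finally have "?p * \<bar>?I - G m \<beta>\<bar> \<le> ?p * (3 * exp l * (1 + \<bar>m\<bar>)\<^sup>2)"
    by (intro mult_left_mono) auto
  also have "\<dots> = 3 * exp l * (?p * (1 + \<bar>m\<bar>)\<^sup>2)" by simp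
  also have "\<dots> \<le> 3 * exp l * (64 * (1 + \<Lambda>)\<^sup>2 * exp (- (4 / 3) * l))"
    by (intro mult_left_mono far_prob False) auto
  also have "\<dots> = 192 * (1 + \<Lambda>)\<^sup>2 * (exp l * exp (- (4 / 3) * l))" by simp
  also have "exp l * exp (- (4 / 3) * l) = exp (- l / 3)"
    by (simp flip: exp_add)
  finally show ?thesis
    by (elim order_trans) simp
qed

text \<open>The same dichotomy; the clipping level now enters squared, so the far exponent is 2 -
  4/3. The centre \<open>c\<close> will be a linear branch evaluated at \<open>m\<close>.\<close>

lemma middle_second_moment:
  assumes c: "\<bar>c\<bar> \<le> \<bar>m\<bar>"
  shows "measure std_normal_distribution {x. \<bar>m + s * x\<bar> \<le> \<Lambda>} *
     (LINT x|std_normal_distribution. (S s (m + s * x) - c)\<^sup>2)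
   \<le> 2 * (real K + 1)\<^sup>2 * exp (9 / 10 * l) + 2 * l + 64 * (1 + \<Lambda>)\<^sup>2 * exp (2 / 3 * l)"
  (is "?p * ?I \<le> ?a + ?b")
proof (cases near)
  case True
  have "?I \<le> (LINT x|std_normal_distribution. 2 * (S_sum \<beta> K s (m + s * x))\<^sup>2 + 2 * c\<^sup>2)"
  proof (intro integral_mono S_integrable Bochner_Integration.integrable_add integrable_mult_right integrable_S_sum)
    fix x
    let ?y = "S s (m + s * x)"
    have "\<bar>?y\<bar> \<le> \<bar>S_sum \<beta> K s (m + s * x)\<bar>"
      by (simp add: S_def abs_clip_le)
    then have "?y\<^sup>2 \<le> (S_sum \<beta> K s (m + s * x))\<^sup>2"
      by (simp add: abs_le_square_iff)
    moreover have "0 \<le> (?y + c)\<^sup>2" by simp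
    ultimately show "(?y - c)\<^sup>2 \<le> 2 * (S_sum \<beta> K s (m + s * x))\<^sup>2 + 2 * c\<^sup>2"
      unfolding power2_sum power2_diff by linarith
  qed simp
  also have "\<dots> = 2 * (LINT x|std_normal_distribution. (S_sum \<beta> K s (m + s * x))\<^sup>2) + 2 * c\<^sup>2"
    using std_normal.prob_space by (simp add: integrable_S_sum)
  also have "\<dots> \<le> 2 * ((real K + 1)\<^sup>2 * exp (9 / 10 * l)) + 2 * l"
  proof (intro add_mono mult_left_mono near_second_moment True)
    have "c\<^sup>2 \<le> m\<^sup>2" using c by (simp add: abs_le_square_iff)
    also have "\<dots> \<le> 32 / 9 * (g + \<sigma>)\<^sup>2 * l"
      by (rule near_sq[OF True])
    also have "\<dots> \<le> 32 / 9 * (1 / (2 * exp 1)) * l"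
      using g_\<sigma> l by (intro mult_right_mono mult_left_mono) auto
    \<comment> \<open>The constant is \<open>16 / (9 * e)\<close>, which is below 1.\<close>
    also have "\<dots> \<le> 1 * l"
      using e_ge l by (intro mult_right_mono) (auto simp: field_simps)
    finally show "c\<^sup>2 \<le> l" by simp
  qed auto
  finally have "?I \<le> ?a" by simp
  moreover have "0 \<le> ?I" by simp
  ultimately have "?p * ?I \<le> 1 * ?a"
    by (intro mult_mono std_normal.prob_le_1) auto
  then show ?thesis by (simp add: add_increasing2)
next
  case False
  have "?I \<le> exp (2 * l) * (1 + \<bar>m\<bar>)\<^sup>2"
  proof (rule std_normal.integral_le_const[OF S_integrable(2)])
    have "\<bar>S s (m + s * x) - c\<bar> \<le> exp l * (1 + \<bar>m\<bar>)" for x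
    proof -
      have "\<bar>S s (m + s * x)\<bar> \<le> exp l"
        by (simp add: S_def abs_clip_le)
      moreover have "1 * \<bar>m\<bar> \<le> exp l * \<bar>m\<bar>"
        using l by (intro mult_right_mono) auto
      ultimately show ?thesis
        using c by (simp add: algebra_simps)
    qed
    then have "\<bar>S s (m + s * x) - c\<bar>\<^sup>2 \<le> (exp l * (1 + \<bar>m\<bar>))\<^sup>2" for x
      by (rule power_mono) simp
    then show "AE x in std_normal_distribution. (S s (m + s * x) - c)\<^sup>2 \<le> exp (2 * l) * (1 + \<bar>m\<bar>)\<^sup>2"
      by (simp add: power_mult_distrib exp_double)
  qed
  then have "?p * ?I \<le> ?p * (exp (2 * l) * (1 + \<bar>m\<bar>)\<^sup>2)"
    by (intro mult_left_mono) auto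
  also have "\<dots> = exp (2 * l) * (?p * (1 + \<bar>m\<bar>)\<^sup>2)" by simp
  also have "\<dots> \<le> exp (2 * l) * (64 * (1 + \<Lambda>)\<^sup>2 * exp (- (4 / 3) * l))"
    by (intro mult_left_mono far_prob False) auto
  also have "\<dots> = 64 * (1 + \<Lambda>)\<^sup>2 * (exp (2 * l) * exp (- (4 / 3) * l))" by simp
  also have "exp (2 * l) * exp (- (4 / 3) * l) = exp (2 / 3 * l)"
    by (simp flip: exp_add)
  finally show ?thesis
    using l by (elim order_trans) simp
qed

section \<open>The two outer events\<close>

lemma lower_prob_le:
  "0 \<le> \<Lambda> + m \<Longrightarrow> measure std_normal_distribution {x. m + s * x < - \<Lambda>} \<le> exp (- (\<Lambda> + m)\<^sup>2 / 2)"
proof -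
  assume "0 \<le> \<Lambda> + m"
  have "measure std_normal_distribution {x. m + s * x < - \<Lambda>}
     \<le> measure std_normal_distribution {x. \<Lambda> + m \<le> - 1 * (s * x)}"
    by (intro std_normal.finite_measure_mono) auto
  also have "\<dots> \<le> exp (- (\<Lambda> + m)\<^sup>2 / (2 * 1\<^sup>2))"
    using \<open>0 \<le> \<Lambda> + m\<close> s \<sigma>_le_1 by (intro std_normal_scaled_tail) auto
  finally show ?thesis by simp
qed

lemma upper_prob_le:
  "0 \<le> \<Lambda> - m \<Longrightarrow> measure std_normal_distribution {x. \<Lambda> < m + s * x} \<le> exp (- (\<Lambda> - m)\<^sup>2 / 2)"
proof -
  assume "0 \<le> \<Lambda> - m"
  have "measure std_normal_distribution {x. \<Lambda> < m + s * x}
     \<le> measure std_normal_distribution {x. \<Lambda> - m \<le> 1 * (s * x)}"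
    by (intro std_normal.finite_measure_mono) auto
  also have "\<dots> \<le> exp (- (\<Lambda> - m)\<^sup>2 / (2 * 1\<^sup>2))"
    using \<open>0 \<le> \<Lambda> - m\<close> s \<sigma>_le_1 by (intro std_normal_scaled_tail) auto
  finally show ?thesis by simp
qed

text \<open>Either the branch is centred at \<open>c\<close>, which leaves only the noise variance,
  or its probability is Gaussian small in \<open>m\<close> and beats the quadratic growth through
  \<open>1 + m^2 / 2 \<le> exp (m^2 / 2)\<close>.\<close>

lemma outer_second_moment:
  assumes q: "0 \<le> q" "q \<le> 1" and b: "\<bar>b\<bar> \<le> 1" "\<bar>b * m - c\<bar> \<le> \<bar>m\<bar>"
    and opp: "b * m = c \<or> q \<le> exp (- m\<^sup>2 / 2)"
  shows "q * (LINT x|std_normal_distribution. (b * (m + s * x) - c)\<^sup>2) \<le> 2"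
proof -
  have "(LINT x|std_normal_distribution. (b * (m + s * x) - c)\<^sup>2)
     = (LINT x|std_normal_distribution. ((b * m - c) + (b * s) * x)\<^sup>2)"
    by (simp add: algebra_simps)
  also have "\<dots> = (b * m - c)\<^sup>2 + (b * s)\<^sup>2"
    by (rule integral_affine_std_normal)
  finally have I: "(LINT x|std_normal_distribution. (b * (m + s * x) - c)\<^sup>2) = (b * m - c)\<^sup>2 + (b * s)\<^sup>2" .
  have "\<bar>b * s\<bar> \<le> 1 * 1"
    unfolding abs_mult using b s \<sigma>_le_1 by (intro mult_mono) auto
  then have bs: "(b * s)\<^sup>2 \<le> 1" by (simp add: abs_square_le_1)
  have "q * (b * m - c)\<^sup>2 + q * (b * s)\<^sup>2 \<le> 2"
  proof (cases "b * m = c")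
    case True
    have "q * (b * s)\<^sup>2 \<le> 1 * 1" using q bs by (intro mult_mono) auto
    then show ?thesis using True by simp
  next
    case False
    have "(b * m - c)\<^sup>2 \<le> m\<^sup>2" using b(2) by (simp add: abs_le_square_iff)
    then have "(b * m - c)\<^sup>2 + (b * s)\<^sup>2 \<le> 2 * (1 + m\<^sup>2 / 2)" using bs by simp
    also have "\<dots> \<le> 2 * exp (m\<^sup>2 / 2)"
      by (intro mult_left_mono exp_ge_add_one_self) simp
    finally have "q * ((b * m - c)\<^sup>2 + (b * s)\<^sup>2) \<le> exp (- m\<^sup>2 / 2) * (2 * exp (m\<^sup>2 / 2))"
      using False opp q by (intro mult_mono) auto
    also have "\<dots> = 2" by (simp flip: exp_add)
    finally show ?thesis by (simp add: distrib_left)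
  qed
  then show ?thesis unfolding I by (simp add: distrib_left)
qed

lemma outer_bias:
  "measure std_normal_distribution {x. m + s * x < - \<Lambda>} * \<bar>- \<beta> * m - G m \<beta>\<bar> \<le> 2 * exp (- \<Lambda>\<^sup>2 / 16)"
  "measure std_normal_distribution {x. \<Lambda> < m + s * x} * \<bar>(1 - \<beta>) * m - G m \<beta>\<bar> \<le> 2 * exp (- \<Lambda>\<^sup>2 / 16)"
proof -
  have 1: "\<bar>- \<beta> * m - G m \<beta>\<bar> = \<bar>G m \<beta> + \<beta> * m\<bar>" by linarith
  show "measure std_normal_distribution {x. m + s * x < - \<Lambda>} * \<bar>- \<beta> * m - G m \<beta>\<bar> \<le> 2 * exp (- \<Lambda>\<^sup>2 / 16)"
    unfolding 1
    by (rule tail_product_le[of _ _ m]) (use \<Lambda>_nonneg lower_prob_le G_minus_lower[OF \<beta>] in auto)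
  have 2: "\<bar>(1 - \<beta>) * m - G m \<beta>\<bar> = \<bar>G m \<beta> - (1 - \<beta>) * m\<bar>" by linarith
  \<comment> \<open>Replacing \<open>m\<close> by \<open>- m\<close> reduces the upper branch to the
    same product estimate.\<close>
  show "measure std_normal_distribution {x. \<Lambda> < m + s * x} * \<bar>(1 - \<beta>) * m - G m \<beta>\<bar> \<le> 2 * exp (- \<Lambda>\<^sup>2 / 16)"
    unfolding 2
    by (rule tail_product_le[of _ _ "- m"]) (use \<Lambda>_nonneg upper_prob_le G_minus_upper[OF \<beta>] in auto)
qed

section \<open>Bias and variance of the whole estimator\<close>

context
  fixes M :: "'w measure" and A B :: "'w \<Rightarrow> real"
  assumes M: "prob_space M"
    and A: "distr M borel A = std_normal_distribution" and B: "distr M borel B = std_normal_distribution"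
    and indep: "prob_space.indep_var M borel A borel B"
begin

abbreviation "T \<equiv> \<lambda>\<omega>. thresholded \<Lambda> (\<lambda>u. - \<beta> * u) (S s) (\<lambda>u. (1 - \<beta>) * u) (m + s * A \<omega>) (m + s * B \<omega>)"

lemma affine_integrable:
  "integrable std_normal_distribution (\<lambda>x. b * (m + s * x))"
  "integrable std_normal_distribution (\<lambda>x. (b * (m + s * x) - c)\<^sup>2)"
  "(LINT x|std_normal_distribution. b * (m + s * x)) = b * m"
proof -
  have eq: "b * (m + s * x) - c = (b * m - c) + (b * s) * x" for x c
    by (simp add: algebra_simps)
  show "integrable std_normal_distribution (\<lambda>x. b * (m + s * x))"
    "(LINT x|std_normal_distribution. b * (m + s * x)) = b * m"
    using integral_affine_std_normal(1,3)[of "b * m" "b * s"] eq[of _ 0] by simp_all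
  show "integrable std_normal_distribution (\<lambda>x. (b * (m + s * x) - c)\<^sup>2)"
    unfolding eq by (rule integral_affine_std_normal)
qed

text \<open>Squaring acts on the selected branch alone, so the squared deviation is again a
  three-branch rule.\<close>

lemma T_sq:
  "(T \<omega> - c)\<^sup>2 = thresholded \<Lambda> (\<lambda>u. (- \<beta> * u - c)\<^sup>2) (\<lambda>u. (S s u - c)\<^sup>2) (\<lambda>u. ((1 - \<beta>) * u - c)\<^sup>2)
     (m + s * A \<omega>) (m + s * B \<omega>)"
  by (cases "m + s * B \<omega> < - \<Lambda>"; cases "\<bar>m + s * B \<omega>\<bar> \<le> \<Lambda>") (simp_all add: thresholded_def)

lemma integrable_T: "integrable M T" "integrable M (\<lambda>\<omega>. (T \<omega>)\<^sup>2)"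
proof -
  interpret prob_space M by (rule M)
  show "integrable M T"
    by (rule thresholded_expectation(1)[OF A B indep affine_integrable(1) S_integrable(1) affine_integrable(1) \<Lambda>_nonneg])
  show "integrable M (\<lambda>\<omega>. (T \<omega>)\<^sup>2)"
    using thresholded_expectation(1)[OF A B indep affine_integrable(2)[of "- \<beta>" 0] S_integrable(2)[of 0]
        affine_integrable(2)[of "1 - \<beta>" 0] \<Lambda>_nonneg]
    by (simp only: T_sq[where c=0, unfolded diff_zero] diff_zero)
qed

lemma bias_le:
  "\<bar>prob_space.expectation M T - G m \<beta>\<bar> \<le> 4 * exp (- \<Lambda>\<^sup>2 / 16) +
     (7 * (6 / 7) ^ K + (real K + 1)\<^sup>2 * exp (- l / 10) + 192 * (1 + \<Lambda>)\<^sup>2 * exp (- l / 3))"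
proof -
  interpret prob_space M by (rule M)
  let ?p1 = "measure std_normal_distribution {x. m + s * x < - \<Lambda>}"
  let ?p2 = "measure std_normal_distribution {x. \<bar>m + s * x\<bar> \<le> \<Lambda>}"
  let ?p3 = "measure std_normal_distribution {x. \<Lambda> < m + s * x}"
  let ?I = "LINT x|std_normal_distribution. S s (m + s * x)"
  note E = thresholded_expectation(2,3)[OF A B indep affine_integrable(1) S_integrable(1) affine_integrable(1) \<Lambda>_nonneg]
  \<comment> \<open>The branch probabilities sum to 1, so the target can be subtracted branch by
    branch.\<close>
  have "expectation T - G m \<beta> = ?p1 * (- \<beta> * m) + ?p2 * ?I + ?p3 * ((1 - \<beta>) * m) - (?p1 + ?p2 + ?p3) * G m \<beta>"
    using E(2) by (simp only: E(1) affine_integrable(3))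
  also have "\<dots> = ?p1 * (- \<beta> * m - G m \<beta>) + ?p2 * (?I - G m \<beta>) + ?p3 * ((1 - \<beta>) * m - G m \<beta>)"
    by (simp add: ring_distribs)
  finally have "\<bar>expectation T - G m \<beta>\<bar> =
     \<bar>?p1 * (- \<beta> * m - G m \<beta>) + ?p2 * (?I - G m \<beta>) + ?p3 * ((1 - \<beta>) * m - G m \<beta>)\<bar>"
    by (simp only:)
  also have "\<dots> \<le> ?p1 * \<bar>- \<beta> * m - G m \<beta>\<bar> + ?p2 * \<bar>?I - G m \<beta>\<bar> + ?p3 * \<bar>(1 - \<beta>) * m - G m \<beta>\<bar>"
    by (intro order_trans[OF abs_triangle_ineq] add_mono) (simp_all add: abs_mult)
  finally show ?thesis
    using outer_bias middle_bias by linarith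
qed

lemma variance_le:
  "prob_space.variance M T \<le> 4 +
     (2 * (real K + 1)\<^sup>2 * exp (9 / 10 * l) + 2 * l + 64 * (1 + \<Lambda>)\<^sup>2 * exp (2 / 3 * l))"
proof -
  interpret prob_space M by (rule M)
  let ?p1 = "measure std_normal_distribution {x. m + s * x < - \<Lambda>}"
  let ?p2 = "measure std_normal_distribution {x. \<bar>m + s * x\<bar> \<le> \<Lambda>}"
  let ?p3 = "measure std_normal_distribution {x. \<Lambda> < m + s * x}"
  \<comment> \<open>The linear branch on the side of \<open>m\<close>. Among the outer branches only
    the opposite one can be off centre, and its selection is Gaussian unlikely.\<close>
  define c where "c = (if 0 \<le> m then (1 - \<beta>) * m else - \<beta> * m)"
  have b: "\<bar>- \<beta>\<bar> \<le> 1" "\<bar>1 - \<beta>\<bar> \<le> 1" using \<beta> by auto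
  have scaled: "\<bar>a * m\<bar> \<le> \<bar>m\<bar>" if "\<bar>a\<bar> \<le> 1" for a
    using mult_right_mono[OF that, of "\<bar>m\<bar>"] by (simp add: abs_mult)
  have c: "\<bar>c\<bar> \<le> \<bar>m\<bar>"
    using scaled[OF b(1)] scaled[OF b(2)] by (cases "0 \<le> m") (simp_all only: c_def if_True if_False)
  have diff: "- \<beta> * m - c = (if 0 \<le> m then - m else 0)" "(1 - \<beta>) * m - c = (if 0 \<le> m then 0 else m)"
    by (simp_all add: c_def algebra_simps)
  have mono: "exp (- (\<Lambda> + y)\<^sup>2 / 2) \<le> exp (- y\<^sup>2 / 2)" if "0 \<le> y" for y
    using power_mono[of y "\<Lambda> + y" 2] that \<Lambda>_nonneg by simp
  have p1: "- \<beta> * m = c \<or> ?p1 \<le> exp (- m\<^sup>2 / 2)"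
  proof (cases "0 \<le> m")
    case True
    then show ?thesis
      using lower_prob_le mono[of m] \<Lambda>_nonneg by (intro disjI2) (auto intro: order_trans)
  qed (simp add: c_def)
  have p3: "(1 - \<beta>) * m = c \<or> ?p3 \<le> exp (- m\<^sup>2 / 2)"
  proof (cases "0 \<le> m")
    case False
    then show ?thesis
      using upper_prob_le mono[of "- m"] \<Lambda>_nonneg by (intro disjI2) (auto intro: order_trans)
  qed (simp add: c_def)
  note E = thresholded_expectation(2)[OF A B indep affine_integrable(2)[of "- \<beta>" c] S_integrable(2)[of c]
      affine_integrable(2)[of "1 - \<beta>" c] \<Lambda>_nonneg, folded T_sq]
  have "variance T \<le> expectation (\<lambda>\<omega>. (T \<omega> - c)\<^sup>2)"
    by (rule variance_le_second_moment[OF integrable_T])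
  also have "\<dots> \<le> 2 + (2 * (real K + 1)\<^sup>2 * exp (9 / 10 * l) + 2 * l + 64 * (1 + \<Lambda>)\<^sup>2 * exp (2 / 3 * l)) + 2"
    unfolding E
  proof (intro add_mono middle_second_moment c)
    have d: "\<bar>- \<beta> * m - c\<bar> \<le> \<bar>m\<bar>" "\<bar>(1 - \<beta>) * m - c\<bar> \<le> \<bar>m\<bar>"
      unfolding diff by simp_all
    show "?p1 * (LINT x|std_normal_distribution. (- \<beta> * (m + s * x) - c)\<^sup>2) \<le> 2"
      by (rule outer_second_moment[OF measure_nonneg std_normal.prob_le_1 b(1) d(1) p1])
    show "?p3 * (LINT x|std_normal_distribution. ((1 - \<beta>) * (m + s * x) - c)\<^sup>2) \<le> 2"
      by (rule outer_second_moment[OF measure_nonneg std_normal.prob_le_1 b(2) d(2) p3])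
  qed
  finally show ?thesis by simp
qed

end

end

end

section \<open>Uniform limits\<close>

text \<open>Free of \<open>\<theta>\<close> and \<open>\<tau>\<close>, so a bound in these terms is
  automatically uniform.\<close>

definition bias_bound :: "real \<Rightarrow> nat \<Rightarrow> real \<Rightarrow> real" where
  "bias_bound \<Lambda> K l = 4 * exp (- \<Lambda>\<^sup>2 / 16) +
     (7 * (6 / 7) ^ K + (real K + 1)\<^sup>2 * exp (- l / 10) + 192 * (1 + \<Lambda>)\<^sup>2 * exp (- l / 3))"

definition variance_bound :: "real \<Rightarrow> nat \<Rightarrow> real \<Rightarrow> real" where
  "variance_bound \<Lambda> K l = 4 +
     (2 * (real K + 1)\<^sup>2 * exp (9 / 10 * l) + 2 * l + 64 * (1 + \<Lambda>)\<^sup>2 * exp (2 / 3 * l))"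

section \<open>From the parameters of a coordinate to the abstract estimator\<close>

lemma shrink_bounds:
  assumes "0 < vp"
  shows "0 \<le> shrink vp \<tau>" "shrink vp \<tau> \<le> 1"
  using assms add_nonneg_pos[OF enn2real_nonneg assms, of \<tau>]
  by (auto simp: shrink_def divide_le_eq_1)

lemma d_coef_nonpos: "0 < vp \<Longrightarrow> 0 < vf \<Longrightarrow> d_coef vp vf \<tau> \<le> 0"
  using shrink_bounds(2)[of vp \<tau>] by (simp add: d_coef_def)

text \<open>Whatever \<open>\<tau>\<close> is, the numerator in
  \<open>\<bar>d_coef vp vf \<tau>\<bar>\<close> is at most 1 and the denominator at least
  \<open>sqrt vf\<close>.\<close>

lemma s_scale_le:
  assumes "0 < vp" "0 < vf"
  shows "s_scale vp vf \<tau> \<le> sqrt (2 * vp / vf)"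
proof -
  have "\<bar>d_coef vp vf \<tau>\<bar> = (1 - shrink vp \<tau>) / sqrt (vf + (shrink vp \<tau>)\<^sup>2 * vp)"
    using shrink_bounds[of vp \<tau>] assms by (simp add: d_coef_def)
  also have "\<dots> \<le> 1 / sqrt vf"
    using shrink_bounds[of vp \<tau>] assms by (intro frac_le) auto
  finally have "s_scale vp vf \<tau> \<le> sqrt (2 * vp) * (1 / sqrt vf)"
    using assms unfolding s_scale_def by (intro mult_left_mono) auto
  then show ?thesis by (simp add: real_sqrt_divide)
qed

lemma truncated_Hermite_estimator_coordinate:
  assumes v: "0 < vp" "0 < vf" and \<beta>: "0 < \<beta>" "\<beta> < 1"
    and g: "0 < g" "g < 1 / sqrt (4 * exp 1) - sqrt (vp / vf)" and n: "0 \<le> ln (real n)"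
  shows "truncated_Hermite_estimator \<beta> g (sqrt (2 * vp / vf)) (ln (real n)) (K_order vp vf g n)"
proof
  define q where "q = sqrt (vp / vf)"
  define a where "a = 1 / sqrt (4 * exp (1::real))"
  have \<sigma>: "sqrt (2 * vp / vf) = sqrt 2 * q"
    by (simp add: q_def real_sqrt_mult[symmetric])
  have q: "0 < q" "q < a" "g < a - q"
    using v g by (auto simp: q_def a_def)
  \<comment> \<open>Positivity of \<open>g\<close> forces \<open>q < a\<close>. Raising the surplus
    \<open>(sqrt 2 - 1) * q\<close> to its value at \<open>a\<close> gives
    \<open>sqrt 2 * a\<close>, whose square is \<open>1 / (2 * e)\<close>.\<close>
  have "g + sqrt 2 * q \<le> a + (sqrt 2 - 1) * q"
    using q by (simp add: algebra_simps)
  also have "\<dots> \<le> a + (sqrt 2 - 1) * a"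
    using q by (intro add_left_mono mult_left_mono) auto
  also have "\<dots> = sqrt 2 * a" by (simp add: algebra_simps)
  finally have "(g + sqrt 2 * q)\<^sup>2 \<le> (sqrt 2 * a)\<^sup>2"
    using g q by (intro power_mono) auto
  also have "\<dots> = 1 / (2 * exp 1)"
    by (simp add: a_def power_mult_distrib power_divide)
  finally show "(g + sqrt (2 * vp / vf))\<^sup>2 \<le> 1 / (2 * exp 1)"
    unfolding \<sigma> .
  show "0 < sqrt (2 * vp / vf)" using v by simp
  show "0 < K_order vp vf g n" by (simp add: K_order_def)
  show "(exp 1)\<^sup>2 * (g + sqrt (2 * vp / vf))\<^sup>2 * (2 * ln (real n)) \<le> real (K_order vp vf g n)"
    unfolding K_order_def by linarith
qed (fact assms)+

lemma T_hat_eq_thresholded: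
  fixes \<beta> \<theta> x z :: real and \<tau> :: ennreal
  assumes v: "0 < vp" "0 < vf" and n: "0 < n"
  defines "m \<equiv> c_coef vp vf \<beta> \<tau> + d_coef vp vf \<tau> * \<theta>"
    and "s \<equiv> s_scale vp vf \<tau>" and "y \<equiv> (x - \<theta>) / sqrt vp"
  shows "T_hat vp vf \<beta> g n x z \<tau> =
    thresholded (g * sqrt (2 * ln (real n))) (\<lambda>u. - \<beta> * u)
      (\<lambda>u. clip (exp (ln (real n))) (S_sum \<beta> (K_order vp vf g n) s u)) (\<lambda>u. (1 - \<beta>) * u)
      (m + s * (- (y + z) / sqrt 2)) (m + s * ((z - y) / sqrt 2))"
proof -
  let ?d = "d_coef vp vf \<tau>"
  \<comment> \<open>As \<open>?d\<close> is nonpositive, its absolute value is \<open>- ?d\<close>;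
    the minus sign passes into the reflected noise variables.\<close>
  have s: "s / sqrt 2 = - (?d * sqrt vp)"
    using d_coef_nonpos[OF v, of \<tau>] by (simp add: s_def s_scale_def real_sqrt_mult)
  have y: "sqrt vp * y = x - \<theta>"
    using v by (simp add: y_def)
  have "m + s * (- (y + z) / sqrt 2) = m - s / sqrt 2 * (y + z)"
    by (simp add: field_simps)
  also have "\<dots> = c_coef vp vf \<beta> \<tau> + ?d * (\<theta> + sqrt vp * y + sqrt vp * z)"
    unfolding s m_def by (simp add: algebra_simps)
  finally have U: "m + s * (- (y + z) / sqrt 2) = c_coef vp vf \<beta> \<tau> + ?d * (x + sqrt vp * z)"
    by (simp add: y)
  have "m + s * ((z - y) / sqrt 2) = m + s / sqrt 2 * (z - y)" by simp
  also have "\<dots> = c_coef vp vf \<beta> \<tau> + ?d * (\<theta> + sqrt vp * y - sqrt vp * z)"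
    unfolding s m_def by (simp add: algebra_simps)
  finally have V: "m + s * ((z - y) / sqrt 2) = c_coef vp vf \<beta> \<tau> + ?d * (x - sqrt vp * z)"
    by (simp add: y)
  have "exp (ln (real n)) = real n" using n by simp
  then show ?thesis
    unfolding U V by (simp only: T_hat_def Let_def thresholded_def threshold_def S_trunc_def
        S_series_eq_S_sum clip_def s_def)
qed

lemma coordinate_bounds:
  fixes M :: "'w measure" and \<theta> :: real and \<tau> :: ennreal
  assumes v: "0 < vp" "0 < vf" and \<beta>: "0 < \<beta>" "\<beta> < 1"
    and g: "0 < g" "g < 1 / sqrt (4 * exp 1) - sqrt (vp / vf)" and n: "0 < n"
    and M: "prob_space M"
    and X: "distributed M lborel X (normal_density \<theta> (sqrt vp))"
    and Z: "distributed M lborel Z std_normal_density"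
    and indep: "prob_space.indep_var M borel X borel Z"
  defines "m \<equiv> c_coef vp vf \<beta> \<tau> + d_coef vp vf \<tau> * \<theta>"
    and "T \<equiv> \<lambda>\<omega>. T_hat vp vf \<beta> g n (X \<omega>) (Z \<omega>) \<tau>"
    and "\<Lambda> \<equiv> g * sqrt (2 * ln (real n))" and "K \<equiv> K_order vp vf g n"
  shows "integrable M T" "integrable M (\<lambda>\<omega>. (T \<omega>)\<^sup>2)"
    and "\<bar>bias M T (G m \<beta>)\<bar> \<le> bias_bound \<Lambda> K (ln (real n))"
    and "prob_space.variance M T \<le> variance_bound \<Lambda> K (ln (real n))"
proof -
  interpret prob_space M by (rule M)
  define s where "s = s_scale vp vf \<tau>"
  define Y where "Y \<omega> = (X \<omega> - \<theta>) / sqrt vp" for \<omega>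
  define A where "A \<omega> = - (Y \<omega> + Z \<omega>) / sqrt 2" for \<omega>
  define B where "B \<omega> = (Z \<omega> - Y \<omega>) / sqrt 2" for \<omega>
  have Y: "distributed M lborel Y std_normal_density"
    using X v normal_standard_normal_convert[of "sqrt vp" X \<theta>] by (simp add: Y_def[abs_def])
  have indep_YZ: "indep_var borel Y borel Z"
  proof -
    have "indep_var borel ((\<lambda>x. (x - \<theta>) / sqrt vp) \<circ> X) borel ((\<lambda>z. z) \<circ> Z)"
      by (rule indep_var_compose[OF indep]) measurable
    then show ?thesis
      unfolding comp_def Y_def[abs_def] .
  qed
  note AB = indep_std_normal_rotate[OF Y Z indep_YZ, folded A_def B_def]
  interpret E: truncated_Hermite_estimator \<beta> g "sqrt (2 * vp / vf)" "ln (real n)" K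
    unfolding K_def using n by (intro truncated_Hermite_estimator_coordinate v \<beta> g) simp
  have s: "0 \<le> s" "s \<le> sqrt (2 * vp / vf)"
    using s_scale_le[OF v] v by (simp_all add: s_def) (simp add: s_scale_def)
  have T: "T = (\<lambda>\<omega>. thresholded \<Lambda> (\<lambda>u. - \<beta> * u) (E.S s) (\<lambda>u. (1 - \<beta>) * u) (m + s * A \<omega>) (m + s * B \<omega>))"
  proof -
    have S: "E.S s = (\<lambda>u. clip (exp (ln (real n))) (S_sum \<beta> K s u))"
      by (simp add: fun_eq_iff E.S_def)
    show ?thesis
      unfolding S unfolding T_def A_def B_def Y_def m_def s_def \<Lambda>_def K_def
      by (intro ext T_hat_eq_thresholded v n)
  qed
  have \<Lambda>: "\<Lambda> = E.\<Lambda>"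
    by (simp add: \<Lambda>_def E.\<Lambda>_def)
  show "integrable M T" "integrable M (\<lambda>\<omega>. (T \<omega>)\<^sup>2)"
    unfolding T \<Lambda> by (rule E.integrable_T[OF s M AB])+
  show "\<bar>bias M T (G m \<beta>)\<bar> \<le> bias_bound \<Lambda> K (ln (real n))"
    unfolding T \<Lambda> bias_def bias_bound_def by (rule E.bias_le[OF s M AB])
  show "variance T \<le> variance_bound \<Lambda> K (ln (real n))"
    unfolding T \<Lambda> variance_bound_def by (rule E.variance_le[OF s M AB])
qed

section \<open>Limits of the explicit bounds\<close>

lemma loglog_affine_exp_tendsto_0:
  fixes a c d :: real
  assumes "0 < a" "0 < c" "0 < d"
  shows "(\<lambda>n. ln (ln (real n)) ^ 8 * ((c * ln (real n) + d)\<^sup>2 * exp (- a * ln (real n)))) \<longlonglongrightarrow> 0"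
proof -
  \<comment> \<open>In the variable \<open>x = ln n\<close> the iterated logarithm is only
    \<open>ln x\<close>, and the exponential decay wins.\<close>
  have "((\<lambda>x. ln x ^ 8 * ((c * x + d)\<^sup>2 * exp (- a * x))) \<longlongrightarrow> 0) at_top"
    using assms by real_asymp
  moreover have "filterlim (\<lambda>n. ln (real n)) at_top sequentially"
    by real_asymp
  ultimately show ?thesis
    by (rule filterlim_compose)
qed

lemma loglog_sqrt_exp_tendsto_0:
  fixes a c :: real
  assumes "0 < a" "0 < c"
  shows "(\<lambda>n. ln (ln (real n)) ^ 8 * ((1 + c * sqrt (2 * ln (real n)))\<^sup>2 * exp (- a * ln (real n)))) \<longlonglongrightarrow> 0"
proof -
  have "((\<lambda>x. ln x ^ 8 * ((1 + c * sqrt (2 * x))\<^sup>2 * exp (- a * x))) \<longlongrightarrow> 0) at_top"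
    using assms by real_asymp
  moreover have "filterlim (\<lambda>n. ln (real n)) at_top sequentially"
    by real_asymp
  ultimately show ?thesis
    by (rule filterlim_compose)
qed

text \<open>Rounding up and adding 1 raises the real expression by between 1 and 2. The lower bound
  makes \<open>(6 / 7) ^ K\<close> decay, the upper one keeps \<open>(K + 1)^2\<close> quadratic in
  \<open>ln n\<close>.\<close>

lemma K_order_bounds:
  fixes vp vf g :: real
  defines "\<kappa> \<equiv> 2 * (exp 1)\<^sup>2 * (g + sqrt (2 * vp / vf))\<^sup>2"
  assumes "0 \<le> ln (real n)"
  shows "\<kappa> * ln (real n) \<le> real (K_order vp vf g n)" "real (K_order vp vf g n) \<le> \<kappa> * ln (real n) + 2"
proof -
  have eq: "(exp 1)\<^sup>2 * (g + sqrt (2 * vp / vf))\<^sup>2 * (2 * ln (real n)) = \<kappa> * ln (real n)"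
    by (simp add: \<kappa>_def)
  have "0 \<le> \<kappa> * ln (real n)" using assms by simp
  then show "\<kappa> * ln (real n) \<le> real (K_order vp vf g n)" "real (K_order vp vf g n) \<le> \<kappa> * ln (real n) + 2"
    unfolding K_order_def eq by linarith+
qed

lemma scaled_bias_bound_tendsto_0:
  assumes "0 < g" "0 < vp" "0 < vf"
  shows "(\<lambda>n. ln (ln (real n)) ^ 8 *
    bias_bound (g * sqrt (2 * ln (real n))) (K_order vp vf g n) (ln (real n))) \<longlonglongrightarrow> 0"
proof -
  define \<kappa> where "\<kappa> = 2 * (exp 1)\<^sup>2 * (g + sqrt (2 * vp / vf))\<^sup>2"
  have "0 < g + sqrt (2 * vp / vf)"
    using assms by (intro add_pos_nonneg) auto
  then have \<kappa>: "0 < \<kappa>" by (simp add: \<kappa>_def)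
  let ?E = "\<lambda>a c d n. ln (ln (real n)) ^ 8 * ((c * ln (real n) + d)\<^sup>2 * exp (- a * ln (real n)))"
  let ?F = "\<lambda>n. ln (ln (real n)) ^ 8 * ((1 + g * sqrt (2 * ln (real n)))\<^sup>2 * exp (- (1 / 3) * ln (real n)))"
  \<comment> \<open>Dominates the four terms of \<open>bias_bound\<close> in their order;
    \<open>g^2 / 8\<close> comes from \<open>\<Lambda>^2 / 16\<close>, and
    \<open>\<kappa> / 7\<close> from the Taylor remainder.\<close>
  let ?B = "\<lambda>n. 4 * ?E (g\<^sup>2 / 8) 1 1 n + (7 * ?E (\<kappa> / 7) 1 1 n + ?E (1 / 10) \<kappa> 3 n + 192 * ?F n)"
  have "?B \<longlonglongrightarrow> 4 * 0 + (7 * 0 + 0 + 192 * 0)"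
    by (intro tendsto_intros loglog_affine_exp_tendsto_0 loglog_sqrt_exp_tendsto_0) (use assms \<kappa> in auto)
  then have B: "?B \<longlonglongrightarrow> 0" by simp
  have "bias_bound (g * sqrt (2 * l)) (K_order vp vf g n) l \<le>
      4 * ((1 * l + 1)\<^sup>2 * exp (- (g\<^sup>2 / 8) * l)) + (7 * ((1 * l + 1)\<^sup>2 * exp (- (\<kappa> / 7) * l))
      + (\<kappa> * l + 3)\<^sup>2 * exp (- (1 / 10) * l)
      + 192 * ((1 + g * sqrt (2 * l))\<^sup>2 * exp (- (1 / 3) * l)))"
    if l: "l = ln (real n)" "0 \<le> l" for n l
  proof -
    let ?K = "K_order vp vf g n"
    have K: "\<kappa> * l \<le> real ?K" "real ?K \<le> \<kappa> * l + 2"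
      using K_order_bounds[where n = n and g = g and vp = vp and vf = vf] l by (simp_all add: \<kappa>_def)
    \<comment> \<open>This factor only brings pure exponentials into the shape of
      \<open>?E\<close>.\<close>
    have one: "1 \<le> (1 * l + 1)\<^sup>2" using l by (intro one_le_power) simp
    have dom: "x \<le> (1 * l + 1)\<^sup>2 * x" if "0 \<le> x" for x
      using mult_right_mono[OF one that] by simp
    have "(g * sqrt (2 * l))\<^sup>2 = 2 * g\<^sup>2 * l"
      using l by (simp add: power_mult_distrib)
    then have 1: "exp (- (g * sqrt (2 * l))\<^sup>2 / 16) \<le> (1 * l + 1)\<^sup>2 * exp (- (g\<^sup>2 / 8) * l)"
      using dom[of "exp (- (g\<^sup>2 / 8) * l)"] by (simp add: mult_ac)
    \<comment> \<open>Since 6/7 is 1 - 1/7, geometric decay in the order becomes a negative power of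
      n.\<close>
    have "(6 / 7 :: real) \<le> exp (- 1 / 7)"
      using exp_ge_add_one_self[of "- 1 / 7"] by simp
    then have "(6 / 7 :: real) ^ ?K \<le> exp (- 1 / 7) ^ ?K"
      by (rule power_mono) simp
    also have "\<dots> = exp (- real ?K / 7)"
      by (simp flip: exp_of_nat_mult)
    also have "\<dots> \<le> exp (- (\<kappa> / 7) * l)"
      using K by simp
    also have "\<dots> \<le> (1 * l + 1)\<^sup>2 * exp (- (\<kappa> / 7) * l)"
      by (rule dom) simp
    finally have 2: "(6 / 7) ^ ?K \<le> (1 * l + 1)\<^sup>2 * exp (- (\<kappa> / 7) * l)" .
    have 3: "(real ?K + 1)\<^sup>2 * exp (- l / 10) \<le> (\<kappa> * l + 3)\<^sup>2 * exp (- (1 / 10) * l)"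
      using K by (intro mult_mono power_mono) auto
    show ?thesis
      unfolding bias_bound_def
      by (intro add_mono mult_left_mono 1 2 3) auto
  qed
  note bound = this[OF refl]
  have le: "ln (ln (real n)) ^ 8 * bias_bound (g * sqrt (2 * ln (real n))) (K_order vp vf g n) (ln (real n)) \<le> ?B n"
    if "0 \<le> ln (real n)" for n
  proof -
    have "ln (ln (real n)) ^ 8 * bias_bound (g * sqrt (2 * ln (real n))) (K_order vp vf g n) (ln (real n))
      \<le> ln (ln (real n)) ^ 8 * (4 * ((1 * ln (real n) + 1)\<^sup>2 * exp (- (g\<^sup>2 / 8) * ln (real n)))
        + (7 * ((1 * ln (real n) + 1)\<^sup>2 * exp (- (\<kappa> / 7) * ln (real n)))
        + (\<kappa> * ln (real n) + 3)\<^sup>2 * exp (- (1 / 10) * ln (real n))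
        + 192 * ((1 + g * sqrt (2 * ln (real n)))\<^sup>2 * exp (- (1 / 3) * ln (real n)))))"
      by (intro mult_left_mono bound that) simp
    also have "\<dots> = ?B n" by (simp only: distrib_left mult_ac)
    finally show ?thesis .
  qed
  show ?thesis
  proof (rule tendsto_sandwich[OF _ _ tendsto_const B])
    have "\<forall>\<^sub>F n in sequentially. 0 \<le> ln (real n)" by real_asymp
    then show "\<forall>\<^sub>F n in sequentially. ln (ln (real n)) ^ 8 * bias_bound (g * sqrt (2 * ln (real n))) (K_order vp vf g n) (ln (real n)) \<le> ?B n"
      by eventually_elim (rule le)
    show "\<forall>\<^sub>F n in sequentially. 0 \<le> ln (ln (real n)) ^ 8 * bias_bound (g * sqrt (2 * ln (real n))) (K_order vp vf g n) (ln (real n))"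
      by (simp add: bias_bound_def)
  qed
qed

lemma scaled_variance_bound_tendsto_0:
  assumes "0 < g" "0 < vp" "0 < vf"
  shows "(\<lambda>n. 1 / real n * ln (ln (real n)) ^ 8 *
    variance_bound (g * sqrt (2 * ln (real n))) (K_order vp vf g n) (ln (real n))) \<longlonglongrightarrow> 0"
proof -
  define \<kappa> where "\<kappa> = 2 * (exp 1)\<^sup>2 * (g + sqrt (2 * vp / vf))\<^sup>2"
  have "0 < g + sqrt (2 * vp / vf)"
    using assms by (intro add_pos_nonneg) auto
  then have \<kappa>: "0 < \<kappa>" by (simp add: \<kappa>_def)
  let ?E = "\<lambda>a c d n. ln (ln (real n)) ^ 8 * ((c * ln (real n) + d)\<^sup>2 * exp (- a * ln (real n)))"
  let ?F = "\<lambda>n. ln (ln (real n)) ^ 8 * ((1 + g * sqrt (2 * ln (real n)))\<^sup>2 * exp (- (1 / 3) * ln (real n)))"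
  let ?B = "\<lambda>n. 4 * ?E 1 1 1 n + 2 * ?E (1 / 10) \<kappa> 3 n + 64 * ?F n"
  have "?B \<longlonglongrightarrow> 4 * 0 + 2 * 0 + 64 * 0"
    by (intro tendsto_intros loglog_affine_exp_tendsto_0 loglog_sqrt_exp_tendsto_0) (use assms \<kappa> in auto)
  then have B: "?B \<longlonglongrightarrow> 0" by simp
  have "exp (- l) * variance_bound (g * sqrt (2 * l)) (K_order vp vf g n) l \<le>
      4 * ((1 * l + 1)\<^sup>2 * exp (- 1 * l)) + 2 * ((\<kappa> * l + 3)\<^sup>2 * exp (- (1 / 10) * l))
      + 64 * ((1 + g * sqrt (2 * l))\<^sup>2 * exp (- (1 / 3) * l))"
    if l: "l = ln (real n)" "0 \<le> l" for n l
  proof -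
    let ?K = "K_order vp vf g n"
    have K: "real ?K \<le> \<kappa> * l + 2"
      using K_order_bounds[where n = n and g = g and vp = vp and vf = vf] l by (simp_all add: \<kappa>_def)
    \<comment> \<open>Division by n makes the exponents 9/10 and 2/3 negative.\<close>
    have e: "exp (- l) * exp (9 / 10 * l) = exp (- (1 / 10) * l)" "exp (- l) * exp (2 / 3 * l) = exp (- (1 / 3) * l)"
      by (simp_all flip: exp_add)
    have "exp (- l) * variance_bound (g * sqrt (2 * l)) ?K l =
      (4 + 2 * l) * exp (- l) + 2 * ((real ?K + 1)\<^sup>2 * (exp (- l) * exp (9 / 10 * l)))
      + 64 * ((1 + g * sqrt (2 * l))\<^sup>2 * (exp (- l) * exp (2 / 3 * l)))"
      unfolding variance_bound_def by (simp add: distrib_left distrib_right mult_ac)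
    also have "\<dots> \<le> 4 * (1 * l + 1)\<^sup>2 * exp (- l) + 2 * ((\<kappa> * l + 3)\<^sup>2 * exp (- (1 / 10) * l))
      + 64 * ((1 + g * sqrt (2 * l))\<^sup>2 * exp (- (1 / 3) * l))"
    proof -
      have "4 + 2 * l \<le> 4 * (1 * l + 1)\<^sup>2"
        using l by (simp add: power2_eq_square algebra_simps)
      moreover have "(real ?K + 1)\<^sup>2 \<le> (\<kappa> * l + 3)\<^sup>2"
        using K by (intro power_mono) auto
      ultimately show ?thesis
        unfolding e by (intro add_mono mult_left_mono mult_right_mono) auto
    qed
    finally show ?thesis by simp
  qed
  note bound = this[OF refl]
  have le: "1 / real n * ln (ln (real n)) ^ 8 * variance_bound (g * sqrt (2 * ln (real n))) (K_order vp vf g n) (ln (real n)) \<le> ?B n"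
    if "0 \<le> ln (real n)" "0 < n" for n
  proof -
    have "exp (- ln (real n)) = 1 / real n"
      using that by (simp add: exp_minus inverse_eq_divide)
    then have "1 / real n * ln (ln (real n)) ^ 8 * variance_bound (g * sqrt (2 * ln (real n))) (K_order vp vf g n) (ln (real n))
      = ln (ln (real n)) ^ 8 * (exp (- ln (real n)) * variance_bound (g * sqrt (2 * ln (real n))) (K_order vp vf g n) (ln (real n)))"
      by simp
    also have "\<dots> \<le> ln (ln (real n)) ^ 8 * (4 * ((1 * ln (real n) + 1)\<^sup>2 * exp (- 1 * ln (real n))) +
        2 * ((\<kappa> * ln (real n) + 3)\<^sup>2 * exp (- (1 / 10) * ln (real n)))
      + 64 * ((1 + g * sqrt (2 * ln (real n)))\<^sup>2 * exp (- (1 / 3) * ln (real n))))"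
      by (intro mult_left_mono bound that) simp
    also have "\<dots> = ?B n" by (simp only: distrib_left mult_ac)
    finally show ?thesis .
  qed
  show ?thesis
  proof (rule tendsto_sandwich[OF _ _ tendsto_const B])
    have "\<forall>\<^sub>F n in sequentially. 0 \<le> ln (real n)" by real_asymp
    then show "\<forall>\<^sub>F n in sequentially. 1 / real n * ln (ln (real n)) ^ 8 * variance_bound (g * sqrt (2 * ln (real n))) (K_order vp vf g n) (ln (real n)) \<le> ?B n"
      using eventually_gt_at_top[of 0] by eventually_elim (rule le)
    have "\<forall>\<^sub>F n in sequentially. 0 \<le> ln (real n)" by real_asymp
    then show "\<forall>\<^sub>F n in sequentially. 0 \<le> 1 / real n * ln (ln (real n)) ^ 8 * variance_bound (g * sqrt (2 * ln (real n))) (K_order vp vf g n) (ln (real n))"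
      by eventually_elim (simp add: variance_bound_def)
  qed
qed

text \<open>A majorant free of \<open>\<tau>\<close> and \<open>\<theta>\<close> passes to both
  suprema, which exist in the extended nonnegative reals without a prior boundedness
  argument.\<close>

lemma SUP_SUP_ennreal_tendsto_0:
  fixes f :: "nat \<Rightarrow> 'a \<Rightarrow> 'b \<Rightarrow> real"
  assumes "\<forall>\<^sub>F n in sequentially. \<forall>\<tau> \<theta>. f n \<tau> \<theta> \<le> B n" and B: "B \<longlonglongrightarrow> 0"
  shows "(\<lambda>n. SUP \<tau>. SUP \<theta>. ennreal (f n \<tau> \<theta>)) \<longlonglongrightarrow> 0"
proof (rule tendsto_sandwich[OF _ _ tendsto_const])
  show "(\<lambda>n. ennreal (B n)) \<longlonglongrightarrow> 0"
    using tendsto_ennrealI[OF B] by simp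
  show "\<forall>\<^sub>F n in sequentially. (SUP \<tau>. SUP \<theta>. ennreal (f n \<tau> \<theta>)) \<le> ennreal (B n)"
    using assms(1) by eventually_elim (auto intro!: SUP_least ennreal_leI)
qed auto

theorem proposition1p1:
  fixes \<nu>p \<nu>f b h \<gamma> :: "nat \<Rightarrow> real"
    and P :: "nat \<Rightarrow> real \<Rightarrow> 'w measure"
    and X Z :: "nat \<Rightarrow> 'w \<Rightarrow> real"
  defines "bt \<equiv> \<lambda>i. critical_ratio (b i) (h i)"
  defines "T \<equiv> \<lambda>i n \<tau> \<omega>. T_hat (\<nu>p i) (\<nu>f i) (bt i) (\<gamma> i) n (X i \<omega>) (Z i \<omega>) \<tau>"
  assumes positive: "\<forall>i\<ge>1. 0 < \<nu>p i \<and> 0 < \<nu>f i \<and> 0 < b i \<and> 0 < h i"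
    and A1: "0 < (INF i\<in>{1..}. ereal (bt i))"
      "(SUP i\<in>{1..}. ereal (bt i)) < 1"
      "(SUP i\<in>{1..}. ereal (b i + h i)) < \<infinity>"
    and A3: "(SUP i\<in>{1..}. ereal (\<nu>p i / \<nu>f i)) < ereal (1 / (4 * exp 1))"
      "(SUP i\<in>{1..}. ereal (\<nu>f i)) < \<infinity>"
      "0 < (INF i\<in>{1..}. ereal (\<nu>p i))"
    and gamma: "\<forall>i\<ge>1. 0 < \<gamma> i \<and> \<gamma> i < 1 / sqrt (4 * exp 1) - sqrt (\<nu>p i / \<nu>f i)"
    and prob: "\<forall>i\<ge>1. \<forall>\<theta>. prob_space (P i \<theta>)"
    and X: "\<forall>i\<ge>1. \<forall>\<theta>. distributed (P i \<theta>) lborel (X i) (normal_density \<theta> (sqrt (\<nu>p i)))"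
    and Z: "\<forall>i\<ge>1. \<forall>\<theta>. distributed (P i \<theta>) lborel (Z i) std_normal_density"
    and indep: "\<forall>i\<ge>1. \<forall>\<theta>. prob_space.indep_var (P i \<theta>) borel (X i) borel (Z i)"
  shows "\<forall>i\<ge>1.
    (\<forall>n \<tau> \<theta>. 0 < ln (ln (real n)) \<longrightarrow>
       integrable (P i \<theta>) (T i n \<tau>) \<and> integrable (P i \<theta>) (\<lambda>\<omega>. (T i n \<tau> \<omega>)\<^sup>2)) \<and>
    ((\<lambda>n. SUP \<tau>. SUP \<theta>.
        ennreal (ln (ln (real n)) ^ 8 *
          \<bar>bias (P i \<theta>) (T i n \<tau>)
             (G (c_coef (\<nu>p i) (\<nu>f i) (bt i) \<tau> + d_coef (\<nu>p i) (\<nu>f i) \<tau> * \<theta>) (bt i))\<bar>))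
      \<longlonglongrightarrow> 0) \<and>
    ((\<lambda>n. SUP \<tau>. SUP \<theta>.
        ennreal (1 / real n * ln (ln (real n)) ^ 8 * prob_space.variance (P i \<theta>) (T i n \<tau>)))
      \<longlonglongrightarrow> 0)"
proof (intro allI impI)
  fix i :: nat
  assume i: "1 \<le> i"
  have v: "0 < \<nu>p i" "0 < \<nu>f i" and g: "0 < \<gamma> i" "\<gamma> i < 1 / sqrt (4 * exp 1) - sqrt (\<nu>p i / \<nu>f i)"
    using positive gamma i by auto
  have \<beta>: "0 < bt i" "bt i < 1"
    using positive i by (auto simp: bt_def critical_ratio_def)
  \<comment> \<open>For \<open>n > 0\<close> the clipping level \<open>exp (ln n)\<close> is
    \<open>n\<close>, so the abstract estimates apply to all \<open>\<tau>\<close> and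
    \<open>\<theta>\<close> at once.\<close>
  have bounds: "integrable (P i \<theta>) (T i n \<tau>)" "integrable (P i \<theta>) (\<lambda>\<omega>. (T i n \<tau> \<omega>)\<^sup>2)"
    "\<bar>bias (P i \<theta>) (T i n \<tau>)
       (G (c_coef (\<nu>p i) (\<nu>f i) (bt i) \<tau> + d_coef (\<nu>p i) (\<nu>f i) \<tau> * \<theta>) (bt i))\<bar>
     \<le> bias_bound (\<gamma> i * sqrt (2 * ln (real n))) (K_order (\<nu>p i) (\<nu>f i) (\<gamma> i) n) (ln (real n))"
    "prob_space.variance (P i \<theta>) (T i n \<tau>)
     \<le> variance_bound (\<gamma> i * sqrt (2 * ln (real n))) (K_order (\<nu>p i) (\<nu>f i) (\<gamma> i) n) (ln (real n))"
    if "0 < n" for n \<tau> \<theta>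
    unfolding T_def
    using coordinate_bounds[OF v \<beta> g that, of "P i \<theta>" "X i" \<theta> "Z i" \<tau>] prob X Z indep i by blast+
  show "(\<forall>n \<tau> \<theta>. 0 < ln (ln (real n)) \<longrightarrow>
       integrable (P i \<theta>) (T i n \<tau>) \<and> integrable (P i \<theta>) (\<lambda>\<omega>. (T i n \<tau> \<omega>)\<^sup>2)) \<and>
    ((\<lambda>n. SUP \<tau>. SUP \<theta>.
        ennreal (ln (ln (real n)) ^ 8 *
          \<bar>bias (P i \<theta>) (T i n \<tau>)
             (G (c_coef (\<nu>p i) (\<nu>f i) (bt i) \<tau> + d_coef (\<nu>p i) (\<nu>f i) \<tau> * \<theta>) (bt i))\<bar>))
      \<longlonglongrightarrow> 0) \<and>
    ((\<lambda>n. SUP \<tau>. SUP \<theta>.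
        ennreal (1 / real n * ln (ln (real n)) ^ 8 * prob_space.variance (P i \<theta>) (T i n \<tau>)))
      \<longlonglongrightarrow> 0)"
  proof (intro conjI allI impI)
    fix n \<tau> \<theta>
    assume "0 < ln (ln (real n))"
    \<comment> \<open>At \<open>n = 0\<close> the convention \<open>ln 0 = 0\<close> makes the
      iterated logarithm zero.\<close>
    then have "0 < n" by (cases n) auto
    then show "integrable (P i \<theta>) (T i n \<tau>)" "integrable (P i \<theta>) (\<lambda>\<omega>. (T i n \<tau> \<omega>)\<^sup>2)"
      by (rule bounds)+
  next
    show "(\<lambda>n. SUP \<tau>. SUP \<theta>.
        ennreal (ln (ln (real n)) ^ 8 *
          \<bar>bias (P i \<theta>) (T i n \<tau>)
             (G (c_coef (\<nu>p i) (\<nu>f i) (bt i) \<tau> + d_coef (\<nu>p i) (\<nu>f i) \<tau> * \<theta>) (bt i))\<bar>))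
      \<longlonglongrightarrow> 0"
      by (rule SUP_SUP_ennreal_tendsto_0[OF _ scaled_bias_bound_tendsto_0[OF g(1) v]])
         (use eventually_gt_at_top[of 0] in eventually_elim, intro allI mult_left_mono bounds, auto)
    show "(\<lambda>n. SUP \<tau>. SUP \<theta>.
        ennreal (1 / real n * ln (ln (real n)) ^ 8 * prob_space.variance (P i \<theta>) (T i n \<tau>)))
      \<longlonglongrightarrow> 0"
      by (rule SUP_SUP_ennreal_tendsto_0[OF _ scaled_variance_bound_tendsto_0[OF g(1) v]])
         (use eventually_gt_at_top[of 0] in eventually_elim, intro allI mult_left_mono bounds, auto)
  qed
qed

end
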